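(* Let $\mathcal P$ be a second-order conic convex set that is a subset of the set of feasible solutions of the continuous relaxation $\overline{\mathrm{HPR}}$ of the high-point relaxation, and let $(x^*,y^* )$ be a bilevel-infeasible extreme point of $\mathcal P$. If $\hat y\in F(x^* )$ is a feasible solution of the follower problem for $x=x^*$ with $q(\hat y)<q(y^* )$, then there is a disjunctive cut that separates $(x^*,y^* )$ from $\mathcal D(\hat y,\mathcal P)$, i.e., a linear inequality $\alpha'x+\beta'y\ge\tau$ valid for $\mathcal D(\hat y,\mathcal P)$ with $\alpha'x^*+\beta'y^*<\tau$, and such a cut can be obtained by solving the (normalized) cut-generating problem (CG-SOCP) for $(x^*,y^* )$, $\hat y$ and $\mathcal P$.
   Context: **Bilevel program.** Prime denotes transpose, $n=n_1+n_2$. The integer bilevel nonlinear program (IBNP) is $$\min\ c'x+d'y\quad\text{s.t. } Mx+Ny\ge h,\ \ \tilde Mx+\tilde Ny-\tilde h\in\mathcal K,\ \ y\in\Omega(x),\ \ x\in\mathbb Z^{n_1},$$ where $\Omega(x)$ is the set of optimal solutions of the follower problem $\min\{q(y): y\in F(x)\}$, $F(x)=\{y\in\mathbb Z^{n_2}: Ax+By\ge f,\ y\in\mathcal Y\}$. Here $c,d,M,N,h,\tilde M,\tilde N,\tilde h$ are real, $A\in\mathbb Z^{m_2\times n_1}$, $B\in\mathbb Z^{m_2\times n_2}$, $f\in\mathbb Z^{m_2}$, with $i$-th rows/entries $A^i,B^i,f_i$ (each $A^i$ and $B^i$ has a nonzero entry); $\mathcal K$ is a cross-product of second-order cones; $\mathcal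 Y$ is a polyhedron; $q(y)=y'Ry+g'y$ with $R=V'V$, $V\in\mathbb R^{n_3\times n_2}$, $n_3\le n_2$. A point $(x,y)\in\mathbb R^n$ is bilevel feasible if it satisfies all constraints of the IBNP, otherwise bilevel infeasible. **Relaxations.** The high-point relaxation (HPR) is $\min\{c'x+d'y: Mx+Ny\ge h,\ \tilde Mx+\tilde Ny-\tilde h\in\mathcal K,\ Ax+By\ge f,\ y\in\mathcal Y,\ (x,y)\in\mathbb Z^n\}$; its continuous relaxation $\overline{\mathrm{HPR}}$ replaces $(x,y)\in\mathbb Z^n$ by the corresponding (finite) variable bound constraints. **Description of $\mathcal P$.** $\mathcal P=\{(x,y)\in\mathbb R^n:\bar Mx+\bar Ny\ge\bar h,\ \tilde Mx+\tilde Ny-\tilde h\in\mathcal K\}$, where the linear system $\bar Mx+\bar Ny\ge\bar h$ bundles all linear constraints of $\overline{\mathrm{HPR}}$ and possibly finitely many further linear inequalities $\mathcal Ax+\mathcal By\ge\mathcal T$ (for instance, disjunctive cuts of the form $\alpha'x+\beta'y\ge\tau$ that have already been generated and added to the relaxation in a cutting-plane or branch-and-cut method). **Disjunctions.** For $\hat y\in\mathcal Y\cap\mathbb Z^{n_2}$ let $\mathcal D_0(\hat y)$ be the condition $q(y)\le q(\hat y)$ and, for $i=1,\dots,m_2$, $\mathcal D_i(\hat y)$ the condition $A^ix\le f_i-B^i\hat y-1$. Put $$\mathcal D(\hat y,\mathcal P)=\operatorname{conv}\Big(\bigcup_{i=0}^{m_2}\{(x,y)\in\mathcal P:\mathcal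 D_i(\hat y)\text{ holds}\}\Big).$$ $\mathcal D_0(\hat y)$ is equivalently written $\tilde Dy-\tilde c\in\mathcal Q$, where $\mathcal Q=\{(z^0,z^1,z^2): z^0\ge\|(z^1,z^2)\|_2\}$ is a standard second-order cone (with $z^0,z^2\in\mathbb R$, $z^1\in\mathbb R^{n_3}$), and $$\tilde D=\begin{pmatrix}-\tfrac12 g'\\ V\\ \tfrac12 g'\end{pmatrix},\qquad \tilde c=\begin{pmatrix}\tfrac{-1-q(\hat y)}2\\ 0\\ \tfrac{-1+q(\hat y)}2\end{pmatrix}.$$ **Cut-generating problem.** (CG-SOCP) is: maximize $\tau-\alpha'x^*-\beta'y^*$ over $(\alpha,\beta,\tau,(\bar\pi_i)_{i=0}^{m_2},(\tilde\pi_i)_{i=0}^{m_2},\sigma,\rho)$ subject to $\alpha'=\bar\pi_i'\bar M+\tilde\pi_i'\tilde M+\sigma_iA^i$ ($i=1,\dots,m_2$); $\alpha'=\bar\pi_0'\bar M+\tilde\pi_0'\tilde M$; $\beta'=\bar\pi_i'\bar N+\tilde\pi_i'\tilde N$ ($i=1,\dots,m_2$); $\beta'=\bar\pi_0'\bar N+\tilde\pi_0'\tilde N+\rho'\tilde D$; $\tau\le\bar\pi_i'\bar h+\tilde\pi_i'\tilde h+\sigma_i(f_i-1-B^i\hat y)$ ($i=1,\dots,m_2$); $\tau\le\bar\pi_0'\bar h+\tilde\pi_0'\tilde h+\rho'\tilde c$; $\sigma\le0$, $\rho\in\mathcal Q^*$, $\bar\pi_i\ge0$, $\tilde\pi_i\in\mathcal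 K^*$ ($i=0,\dots,m_2$), where $^*$ denotes dual cone. Since the feasible region is a cone, a normalization constraint is added: for some $p\in\{1,2\}$ one of $\|((\bar\pi_i)_i,(\tilde\pi_i)_i,\sigma,\rho)\|_p\le1$ (standard), $\|((\bar\pi_i)_i,(\tilde\pi_i)_i)\|_p\le1$ (uniform), $\|(\alpha,\beta)\|_p\le1$ (cut-coefficient). A feasible solution with positive objective value gives the disjunctive cut $\alpha'x+\beta'y\ge\tau$; "can be obtained by solving (CG-SOCP)" means that an optimal solution has positive objective value and so yields such a cut. **Standing assumptions.** (1) All variables are bounded in the HPR (so the feasible set of $\overline{\mathrm{HPR}}$ is bounded) and $\mathcal Y$ is bounded. (2) $\overline{\mathrm{HPR}}$ has a feasible solution satisfying $\tilde Mx+\tilde Ny-\tilde h\in\mathcal K$ strictly (i.e., in the interior of $\mathcal K$), and its dual has a feasible solution. (3) The dual of (CG-SOCP) (with the normalization constraint included) has a feasible solution in its interior, and (CG-SOCP) can be solved exactly. *)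

theory Defs
  imports "HOL-Analysis.Analysis"
begin

section \<open>Cones\<close>

definition dual_cone :: "'a::real_inner set \<Rightarrow> 'a set" where
  "dual_cone K = {w. \<forall>z\<in>K. w \<bullet> z \<ge> 0}"

text \<open>
  Cross-products of second-order cones.  An idempotent map \<open>h\<close> on the coordinates
  encodes a partition of the coordinates into blocks: the block of a coordinate \<open>i\<close> with
  \<open>h i = i\<close> consists of all \<open>j\<close> with \<open>h j = i\<close>, and \<open>i\<close> is its distinguished (first)
  coordinate.  A block of size one gives the half-line of nonnegative reals.
\<close>

definition soc_product :: "(real^'k) set \<Rightarrow> bool" where
  "soc_product K \<longleftrightarrow> (\<exists>h :: 'k \<Rightarrow> 'k. (\<forall>i. h (h i) = h i) \<and>
     K = {z. \<forall>i. h i = i \<longrightarrow> z$i \<ge> sqrt (\<Sum>j | h j = i \<and> j \<noteq> i. (z$j)\<^sup>2)})"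

text \<open>The norm of a pair is the Euclidean norm of the stacked vector.\<close>

definition std_soc :: "(real \<times> (real^'n3) \<times> real) set" where
  "std_soc = {(z0, z1, z2). z0 \<ge> norm (z1, z2)}"


section \<open>The bilevel program and its high-point relaxation\<close>

text \<open>
  \<open>M\<close>, \<open>N\<close>, \<open>h\<close> carry the suffix \<open>lin\<close> for the linear and \<open>con\<close> for the conic (tilde)
  constraints of the leader.  The polyhedron of the follower is \<open>{y. G y \<ge> gY}\<close>.
  The last four fields are the variable bounds that replace integrality in the
  continuous relaxation.
\<close>

record ('n1, 'n2, 'n3, 'm1, 'm2, 'k, 'r2) ibnp =
  c_obj :: "real^'n1"
  d_obj :: "real^'n2"
  M_lin :: "real^'n1^'m1"
  N_lin :: "real^'n2^'m1"
  h_lin :: "real^'m1"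
  M_con :: "real^'n1^'k"
  N_con :: "real^'n2^'k"
  h_con :: "real^'k"
  K_con :: "(real^'k) set"
  A_fol :: "real^'n1^'m2"
  B_fol :: "real^'n2^'m2"
  f_fol :: "real^'m2"
  G_pol :: "real^'n2^'r2"
  gY_pol :: "real^'r2"
  V_obj :: "real^'n2^'n3"
  g_obj :: "real^'n2"
  lb_x :: "real^'n1"
  ub_x :: "real^'n1"
  lb_y :: "real^'n2"
  ub_y :: "real^'n2"

definition int_vec :: "real^'n \<Rightarrow> bool" where
  "int_vec v \<longleftrightarrow> (\<forall>i. v$i \<in> \<int>)"

definition valid_data ::
  "('n1::finite, 'n2::finite, 'n3::finite, 'm1::finite, 'm2::finite, 'k::finite, 'r2::finite) ibnp
    \<Rightarrow> bool" where
  "valid_data I \<longleftrightarrow>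
     CARD('n3) \<le> CARD('n2) \<and>
     soc_product (K_con I) \<and>
     (\<forall>i. int_vec (A_fol I $ i) \<and> int_vec (B_fol I $ i)) \<and> int_vec (f_fol I) \<and>
     (\<forall>i. A_fol I $ i \<noteq> 0 \<and> B_fol I $ i \<noteq> 0)"

definition Y_set ::
  "('n1::finite, 'n2::finite, 'n3::finite, 'm1::finite, 'm2::finite, 'k::finite, 'r2::finite) ibnp
    \<Rightarrow> (real^'n2) set"
  where "Y_set I = {y. G_pol I *v y \<ge> gY_pol I}"

definition q_obj ::
  "('n1::finite, 'n2::finite, 'n3::finite, 'm1::finite, 'm2::finite, 'k::finite, 'r2::finite) ibnp
    \<Rightarrow> real^'n2 \<Rightarrow> real"
  where "q_obj I y = y \<bullet> ((transpose (V_obj I) ** V_obj I) *v y) + g_obj I \<bullet> y"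

definition F_set ::
  "('n1::finite, 'n2::finite, 'n3::finite, 'm1::finite, 'm2::finite, 'k::finite, 'r2::finite) ibnp
    \<Rightarrow> real^'n1 \<Rightarrow> (real^'n2) set" where
  "F_set I x = {y. int_vec y \<and> A_fol I *v x + B_fol I *v y \<ge> f_fol I \<and> y \<in> Y_set I}"

definition Omega ::
  "('n1::finite, 'n2::finite, 'n3::finite, 'm1::finite, 'm2::finite, 'k::finite, 'r2::finite) ibnp
    \<Rightarrow> real^'n1 \<Rightarrow> (real^'n2) set" where
  "Omega I x = {y \<in> F_set I x. \<forall>w\<in>F_set I x. q_obj I y \<le> q_obj I w}"

definition conic_arg ::
  "('n1::finite, 'n2::finite, 'n3::finite, 'm1::finite, 'm2::finite, 'k::finite, 'r2::finite) ibnp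
    \<Rightarrow> real^'n1 \<Rightarrow> real^'n2 \<Rightarrow> real^'k" where
  "conic_arg I x y = M_con I *v x + N_con I *v y - h_con I"

definition bilevel_feasible ::
  "('n1::finite, 'n2::finite, 'n3::finite, 'm1::finite, 'm2::finite, 'k::finite, 'r2::finite) ibnp
    \<Rightarrow> (real^'n1) \<times> (real^'n2) \<Rightarrow> bool" where
  "bilevel_feasible I = (\<lambda>(x, y).
     M_lin I *v x + N_lin I *v y \<ge> h_lin I \<and> conic_arg I x y \<in> K_con I \<and>
     y \<in> Omega I x \<and> int_vec x)"

definition hpr_set ::
  "('n1::finite, 'n2::finite, 'n3::finite, 'm1::finite, 'm2::finite, 'k::finite, 'r2::finite) ibnp
    \<Rightarrow> ((real^'n1) \<times> (real^'n2)) set" where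
  "hpr_set I = {(x, y).
     M_lin I *v x + N_lin I *v y \<ge> h_lin I \<and> conic_arg I x y \<in> K_con I \<and>
     A_fol I *v x + B_fol I *v y \<ge> f_fol I \<and> y \<in> Y_set I \<and> int_vec x \<and> int_vec y}"

definition within_bounds ::
  "('n1::finite, 'n2::finite, 'n3::finite, 'm1::finite, 'm2::finite, 'k::finite, 'r2::finite) ibnp
    \<Rightarrow> real^'n1 \<Rightarrow> real^'n2 \<Rightarrow> bool" where
  "within_bounds I x y \<longleftrightarrow> lb_x I \<le> x \<and> x \<le> ub_x I \<and> lb_y I \<le> y \<and> y \<le> ub_y I"

definition hpr_relax_set ::
  "('n1::finite, 'n2::finite, 'n3::finite, 'm1::finite, 'm2::finite, 'k::finite, 'r2::finite) ibnp
    \<Rightarrow> ((real^'n1) \<times> (real^'n2)) set" where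
  "hpr_relax_set I = {(x, y).
     M_lin I *v x + N_lin I *v y \<ge> h_lin I \<and> conic_arg I x y \<in> K_con I \<and>
     A_fol I *v x + B_fol I *v y \<ge> f_fol I \<and> y \<in> Y_set I \<and> within_bounds I x y}"

text \<open>A triple \<open>(a, b, t)\<close> stands for the inequality \<open>a \<bullet> x + b \<bullet> y \<ge> t\<close>.\<close>

definition sys_rows ::
  "real^'n1^'m \<Rightarrow> real^'n2^'m \<Rightarrow> real^'m \<Rightarrow> ((real^'n1) \<times> (real^'n2) \<times> real) set" where
  "sys_rows M N h = range (\<lambda>i. (M $ i, N $ i, h $ i))"

definition hpr_relax_rows ::
  "('n1::finite, 'n2::finite, 'n3::finite, 'm1::finite, 'm2::finite, 'k::finite, 'r2::finite) ibnp
    \<Rightarrow> ((real^'n1) \<times> (real^'n2) \<times> real) set" where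
  "hpr_relax_rows I =
     sys_rows (M_lin I) (N_lin I) (h_lin I) \<union>
     sys_rows (A_fol I) (B_fol I) (f_fol I) \<union>
     sys_rows 0 (G_pol I) (gY_pol I) \<union>
     sys_rows (mat 1) 0 (lb_x I) \<union> sys_rows (- mat 1) 0 (- ub_x I) \<union>
     sys_rows 0 (mat 1) (lb_y I) \<union> sys_rows 0 (- mat 1) (- ub_y I)"

text \<open>
  Feasibility of the conic dual of the continuous relaxation: nonnegative multipliers
  \<open>u\<close> for its linear rows and \<open>\<kappa>\<close> in the dual cone for its conic constraint.
\<close>

definition hpr_relax_dual_feasible ::
  "('n1::finite, 'n2::finite, 'n3::finite, 'm1::finite, 'm2::finite, 'k::finite, 'r2::finite) ibnp
    \<Rightarrow> bool" where
  "hpr_relax_dual_feasible I \<longleftrightarrow>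
     (\<exists>u \<kappa>. (\<forall>r\<in>hpr_relax_rows I. u r \<ge> 0) \<and> \<kappa> \<in> dual_cone (K_con I) \<and>
       (\<Sum>r\<in>hpr_relax_rows I. u r *\<^sub>R fst r) + \<kappa> v* M_con I = c_obj I \<and>
       (\<Sum>r\<in>hpr_relax_rows I. u r *\<^sub>R fst (snd r)) + \<kappa> v* N_con I = d_obj I)"


section \<open>The region P and the disjunction\<close>

definition P_set ::
  "('n1::finite, 'n2::finite, 'n3::finite, 'm1::finite, 'm2::finite, 'k::finite, 'r2::finite) ibnp
    \<Rightarrow> real^'n1^'r \<Rightarrow> real^'n2^'r \<Rightarrow> real^'r \<Rightarrow> ((real^'n1) \<times> (real^'n2)) set" where
  "P_set I Mb Nb hb = {(x, y). Mb *v x + Nb *v y \<ge> hb \<and> conic_arg I x y \<in> K_con I}"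

text \<open>
  The index set \<open>{0, \<dots>, m2}\<close> of the disjunction is the type \<open>'m2 option\<close>: \<open>None\<close> is the
  index 0 and \<open>Some i\<close> is the index of the \<open>i\<close>-th follower constraint.
\<close>

fun disj_cond ::
  "('n1::finite, 'n2::finite, 'n3::finite, 'm1::finite, 'm2::finite, 'k::finite, 'r2::finite) ibnp
    \<Rightarrow> real^'n2 \<Rightarrow> 'm2 option \<Rightarrow> (real^'n1) \<times> (real^'n2) \<Rightarrow> bool" where
  "disj_cond I yh None (x, y) \<longleftrightarrow> q_obj I y \<le> q_obj I yh"
| "disj_cond I yh (Some i) (x, y) \<longleftrightarrow> A_fol I $ i \<bullet> x \<le> f_fol I $ i - B_fol I $ i \<bullet> yh - 1"

definition disj_hull ::
  "('n1::finite, 'n2::finite, 'n3::finite, 'm1::finite, 'm2::finite, 'k::finite, 'r2::finite) ibnp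
    \<Rightarrow> real^'n2 \<Rightarrow> ((real^'n1) \<times> (real^'n2)) set \<Rightarrow> ((real^'n1) \<times> (real^'n2)) set" where
  "disj_hull I yh P = convex hull (\<Union>i. {z \<in> P. disj_cond I yh i z})"

definition separating_cut ::
  "real^'n1 \<Rightarrow> real^'n2 \<Rightarrow> real \<Rightarrow> real^'n1 \<Rightarrow> real^'n2 \<Rightarrow> ((real^'n1) \<times> (real^'n2)) set \<Rightarrow> bool" where
  "separating_cut \<alpha> \<beta> \<tau> xs ys D \<longleftrightarrow>
     (\<forall>(x, y)\<in>D. \<alpha> \<bullet> x + \<beta> \<bullet> y \<ge> \<tau>) \<and> \<alpha> \<bullet> xs + \<beta> \<bullet> ys < \<tau>"


section \<open>The cut-generating problem\<close>

text \<open>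
  The condition \<open>q y \<le> q yh\<close> in the conic form \<open>D_op I y - c_tilde I yh \<in> std_soc\<close>;
  \<open>D_adj I \<rho>\<close> is the row vector \<open>\<rho>'D\<close>.
\<close>

definition D_op ::
  "('n1::finite, 'n2::finite, 'n3::finite, 'm1::finite, 'm2::finite, 'k::finite, 'r2::finite) ibnp
    \<Rightarrow> real^'n2 \<Rightarrow> real \<times> (real^'n3) \<times> real" where
  "D_op I y = (- (1/2) * (g_obj I \<bullet> y), V_obj I *v y, (1/2) * (g_obj I \<bullet> y))"

fun D_adj ::
  "('n1::finite, 'n2::finite, 'n3::finite, 'm1::finite, 'm2::finite, 'k::finite, 'r2::finite) ibnp
    \<Rightarrow> real \<times> (real^'n3) \<times> real \<Rightarrow> real^'n2" where
  "D_adj I (r0, r1, r2) = r0 *\<^sub>R (- (1/2) *\<^sub>R g_obj I) + r1 v* V_obj I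
     + r2 *\<^sub>R ((1/2) *\<^sub>R g_obj I)"

definition c_tilde ::
  "('n1::finite, 'n2::finite, 'n3::finite, 'm1::finite, 'm2::finite, 'k::finite, 'r2::finite) ibnp
    \<Rightarrow> real^'n2 \<Rightarrow> real \<times> (real^'n3) \<times> real" where
  "c_tilde I yh = ((- 1 - q_obj I yh) / 2, 0, (- 1 + q_obj I yh) / 2)"

record ('n1, 'n2, 'n3, 'm2, 'k, 'r) cg_point =
  cg_alpha :: "real^'n1"
  cg_beta :: "real^'n2"
  cg_tau :: real
  cg_pibar :: "real^'r^'m2 option"
  cg_pitil :: "real^'k^'m2 option"
  cg_sigma :: "real^'m2"
  cg_rho :: "real \<times> (real^'n3) \<times> real"

definition cg_constraints ::
  "('n1::finite, 'n2::finite, 'n3::finite, 'm1::finite, 'm2::finite, 'k::finite, 'r2::finite) ibnp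
    \<Rightarrow> real^'n1^'r \<Rightarrow> real^'n2^'r \<Rightarrow> real^'r \<Rightarrow> real^'n2
    \<Rightarrow> ('n1, 'n2, 'n3, 'm2, 'k, 'r::finite) cg_point
    \<Rightarrow> bool" where
  "cg_constraints I Mb Nb hb yh w \<longleftrightarrow>
     (\<forall>i. cg_alpha w = cg_pibar w $ Some i v* Mb + cg_pitil w $ Some i v* M_con I
                       + cg_sigma w $ i *\<^sub>R A_fol I $ i) \<and>
     cg_alpha w = cg_pibar w $ None v* Mb + cg_pitil w $ None v* M_con I \<and>
     (\<forall>i. cg_beta w = cg_pibar w $ Some i v* Nb + cg_pitil w $ Some i v* N_con I) \<and>
     cg_beta w = cg_pibar w $ None v* Nb + cg_pitil w $ None v* N_con I + D_adj I (cg_rho w) \<and>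
     (\<forall>i. cg_tau w \<le> cg_pibar w $ Some i \<bullet> hb + cg_pitil w $ Some i \<bullet> h_con I
                     + cg_sigma w $ i * (f_fol I $ i - 1 - B_fol I $ i \<bullet> yh)) \<and>
     cg_tau w \<le> cg_pibar w $ None \<bullet> hb + cg_pitil w $ None \<bullet> h_con I + cg_rho w \<bullet> c_tilde I yh \<and>
     cg_sigma w \<le> 0 \<and> cg_rho w \<in> dual_cone std_soc \<and>
     (\<forall>i. cg_pibar w $ i \<ge> 0 \<and> cg_pitil w $ i \<in> dual_cone (K_con I))"

text \<open>
  The \<open>p\<close>-norm of the coordinate vector.  For tuples and for vectors of vectors the
  elements of \<open>Basis\<close> are the coordinates of all components stacked together.
\<close>

definition pnorm :: "nat \<Rightarrow> 'a::euclidean_space \<Rightarrow> real" where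
  "pnorm p v = root p (\<Sum>b\<in>Basis. \<bar>v \<bullet> b\<bar> ^ p)"

datatype normalization = Standard | Uniform | Cut_Coefficient

fun cg_normalized ::
  "normalization \<Rightarrow> nat
    \<Rightarrow> ('n1::finite, 'n2::finite, 'n3::finite, 'm2::finite, 'k::finite, 'r::finite) cg_point
    \<Rightarrow> bool" where
  "cg_normalized Standard p w \<longleftrightarrow> pnorm p (cg_pibar w, cg_pitil w, cg_sigma w, cg_rho w) \<le> 1"
| "cg_normalized Uniform p w \<longleftrightarrow> pnorm p (cg_pibar w, cg_pitil w) \<le> 1"
| "cg_normalized Cut_Coefficient p w \<longleftrightarrow> pnorm p (cg_alpha w, cg_beta w) \<le> 1"

definition cg_feasible ::
  "('n1::finite, 'n2::finite, 'n3::finite, 'm1::finite, 'm2::finite, 'k::finite, 'r2::finite) ibnp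
    \<Rightarrow> real^'n1^'r \<Rightarrow> real^'n2^'r \<Rightarrow> real^'r \<Rightarrow> real^'n2 \<Rightarrow> normalization \<Rightarrow> nat
    \<Rightarrow> ('n1, 'n2, 'n3, 'm2, 'k, 'r::finite) cg_point
    \<Rightarrow> bool" where
  "cg_feasible I Mb Nb hb yh nrm p w \<longleftrightarrow>
     cg_constraints I Mb Nb hb yh w \<and> cg_normalized nrm p w"

definition cg_objective ::
  "real^'n1 \<Rightarrow> real^'n2
    \<Rightarrow> ('n1::finite, 'n2::finite, 'n3::finite, 'm2::finite, 'k::finite, 'r::finite) cg_point
    \<Rightarrow> real" where
  "cg_objective xs ys w = cg_tau w - cg_alpha w \<bullet> xs - cg_beta w \<bullet> ys"

definition cg_optimal ::
  "('n1::finite, 'n2::finite, 'n3::finite, 'm1::finite, 'm2::finite, 'k::finite, 'r2::finite) ibnp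
    \<Rightarrow> real^'n1^'r \<Rightarrow> real^'n2^'r \<Rightarrow> real^'r \<Rightarrow> real^'n1 \<Rightarrow> real^'n2 \<Rightarrow> real^'n2
    \<Rightarrow> normalization \<Rightarrow> nat \<Rightarrow> ('n1, 'n2, 'n3, 'm2, 'k, 'r::finite) cg_point
    \<Rightarrow> bool" where
  "cg_optimal I Mb Nb hb xs ys yh nrm p w \<longleftrightarrow>
     cg_feasible I Mb Nb hb yh nrm p w \<and>
     (\<forall>w'. cg_feasible I Mb Nb hb yh nrm p w' \<longrightarrow> cg_objective xs ys w' \<le> cg_objective xs ys w)"


section \<open>Strict feasibility of the dual of the cut-generating problem\<close>

text \<open>
  The dual is the Lagrangian conic dual.  Its variables are \<open>X i\<close>, \<open>Y i\<close> for the equations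
  that define \<open>\<alpha>\<close> and \<open>\<beta>\<close>, \<open>l i\<close> for the inequalities on \<open>\<tau>\<close>, and \<open>(\<theta>, s)\<close> for the
  normalization written as \<open>(1, v) \<in> norm_cone p\<close>, where \<open>v\<close> collects the normalized
  variables; the dual objective is to minimize \<open>\<theta>\<close>.  The parts of \<open>s\<close> that belong to
  variables not occurring in \<open>v\<close> are zero.  Collecting the coefficients of each variable
  of the cut-generating problem gives the dual constraints below.  A feasible solution lies in
  the interior if every conic (in)equality constraint holds in the interior of its cone.
\<close>

definition norm_cone :: "nat \<Rightarrow> (real \<times> 'a::euclidean_space) set" where
  "norm_cone p = {(t, v). pnorm p v \<le> t}"

fun dual_norm_strict ::
  "normalization \<Rightarrow> nat \<Rightarrow> real \<Rightarrow> real^'n1 \<Rightarrow> real^'n2 \<Rightarrow> real^'r^'m2 option \<Rightarrow> real^'k^'m2 option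
    \<Rightarrow> real^'m2 \<Rightarrow> real \<times> (real^'n3) \<times> real \<Rightarrow> bool" where
  "dual_norm_strict Standard p \<theta> sa sb spb spt ss sr \<longleftrightarrow>
     sa = 0 \<and> sb = 0 \<and> (\<theta>, spb, spt, ss, sr) \<in> interior (dual_cone (norm_cone p))"
| "dual_norm_strict Uniform p \<theta> sa sb spb spt ss sr \<longleftrightarrow>
     sa = 0 \<and> sb = 0 \<and> ss = 0 \<and> sr = 0 \<and> (\<theta>, spb, spt) \<in> interior (dual_cone (norm_cone p))"
| "dual_norm_strict Cut_Coefficient p \<theta> sa sb spb spt ss sr \<longleftrightarrow>
     spb = 0 \<and> spt = 0 \<and> ss = 0 \<and> sr = 0 \<and> (\<theta>, sa, sb) \<in> interior (dual_cone (norm_cone p))"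

definition cg_dual_strictly_feasible ::
  "('n1::finite, 'n2::finite, 'n3::finite, 'm1::finite, 'm2::finite, 'k::finite, 'r2::finite) ibnp
    \<Rightarrow> real^'n1^'r \<Rightarrow> real^'n2^'r \<Rightarrow> real^'r \<Rightarrow> real^'n1 \<Rightarrow> real^'n2 \<Rightarrow> real^'n2
    \<Rightarrow> normalization \<Rightarrow> nat \<Rightarrow> bool" where
  "cg_dual_strictly_feasible I Mb Nb hb xs ys yh nrm p \<longleftrightarrow>
     (\<exists>(X :: real^'n1^'m2 option) (Y :: real^'n2^'m2 option) (l :: real^'m2 option)
        \<theta> sa sb spb spt ss sr.
        (\<Sum>i\<in>UNIV. X $ i) = xs - sa \<and>
        (\<Sum>i\<in>UNIV. Y $ i) = ys - sb \<and>
        (\<Sum>i\<in>UNIV. l $ i) = 1 \<and>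
        (\<forall>i. l $ i > 0) \<and>
        (\<forall>i j. (Mb *v X $ i + Nb *v Y $ i - l $ i *\<^sub>R hb - spb $ i) $ j > 0) \<and>
        (\<forall>i. M_con I *v X $ i + N_con I *v Y $ i - l $ i *\<^sub>R h_con I - spt $ i
               \<in> interior (K_con I)) \<and>
        (\<forall>i. A_fol I $ i \<bullet> X $ Some i - l $ Some i * (f_fol I $ i - 1 - B_fol I $ i \<bullet> yh)
               - ss $ i < 0) \<and>
        D_op I (Y $ None) - l $ None *\<^sub>R c_tilde I yh - sr \<in> interior std_soc \<and>
        dual_norm_strict nrm p \<theta> sa sb spb spt ss sr)"

end

theory Submission
  imports Defs
begin

text \<open>
  The point \<open>(xs, ys)\<close> violates every condition of the disjunction, so, being extreme in \<open>P\<close>,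
  it lies outside the compact hull of the disjuncts and is strictly separated from it.  Every
  disjunct contains the variable bounds among its rows, so any linear functional is a nonnegative
  combination of rows.  This makes conic duality exact for strictly valid inequalities, without a
  Slater point and also for empty disjuncts, and yields multipliers for the separating
  inequality.  Scaling gives a normalized point with positive objective.  Weak duality against a
  strictly feasible dual point bounds the multipliers on the set of nonnegative objective, so
  the maximum is attained.
\<close>

section \<open>Cones and conic duality\<close>

text \<open>Two obstacles shape the proof. The pairs (a, t) that multipliers certify for one
  disjunct form a convex cone that need not be closed, so only weak separation from it is available.
  Strictness of the inequality contradicts a separating functional with nonzero last coordinate, and
  the bound rows exclude a zero one. The strictness itself comes from the compactness of the hull:
  the convex hull of an unbounded closed union could fail to be closed. The other obstacle is
  attainment. The normalization alone need not confine the variables: \<open>Uniform\<close> leaves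
  \<open>cg_sigma\<close> and \<open>cg_rho\<close> out of the norm, \<open>Cut_Coefficient\<close>
  leaves out all multipliers, and \<open>cg_tau\<close> can always be lowered. Therefore only points
  of nonnegative objective are considered. Once their multipliers are bounded, the cut coefficients
  are too, being linear in them, and \<tau> lies between the bound from the objective and one
  inequality of the problem.\<close>

lemma convex_cone_dual_cone: "convex_cone (dual_cone K)"
  by (auto simp: convex_cone_iff dual_cone_def inner_add_left)

lemma closed_dual_cone: "closed (dual_cone K)"
proof -
  have "dual_cone K = (\<Inter>z\<in>K. {w. w \<bullet> z \<ge> 0})"
    by (auto simp: dual_cone_def)
  then show ?thesis
    by (auto intro!: closed_INT closed_Collect_le continuous_intros)
qed

lemma closed_Collect_dual_cone:
  assumes "continuous_on UNIV f"
  shows "closed {x. f x \<in> dual_cone A}"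
  using closed_vimage[OF closed_dual_cone assms] by (simp add: vimage_def)

lemma dual_coneD: "w \<in> dual_cone K \<Longrightarrow> z \<in> K \<Longrightarrow> 0 \<le> w \<bullet> z"
  by (simp add: dual_cone_def)

text \<open>A small step from the interior point \<open>u\<close> in direction \<open>- w\<close>
  stays in \<open>K\<close> and would make the inner product with \<open>w\<close> negative.\<close>

lemma dual_cone_interior_eq_0:
  assumes w: "w \<in> dual_cone K" and u: "u \<in> interior K" and le: "w \<bullet> u \<le> 0"
  shows "w = 0"
proof (rule ccontr)
  assume "w \<noteq> 0"
  obtain e where "e > 0" and e: "cball u e \<subseteq> K"
    using u by (auto simp: mem_interior_cball)
  have "u - (e / norm w) *\<^sub>R w \<in> cball u e"
    using \<open>e > 0\<close> \<open>w \<noteq> 0\<close> by (simp add: dist_norm)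
  then have "0 \<le> w \<bullet> (u - (e / norm w) *\<^sub>R w)"
    using e w by (blast intro: dual_coneD)
  then have "e / norm w * (w \<bullet> w) \<le> w \<bullet> u"
    by (simp add: inner_diff_right)
  moreover have "0 < e / norm w * (w \<bullet> w)"
    using \<open>e > 0\<close> \<open>w \<noteq> 0\<close> by simp
  ultimately show False
    using le by linarith
qed

lemma dual_cone_Times:
  assumes "0 \<in> A" "0 \<in> B"
  shows "dual_cone (A \<times> B) = dual_cone A \<times> dual_cone B"
proof
  show "dual_cone (A \<times> B) \<subseteq> dual_cone A \<times> dual_cone B"
  proof
    fix w assume w: "w \<in> dual_cone (A \<times> B)"
    have "0 \<le> fst w \<bullet> z" if "z \<in> A" for z
      using dual_coneD[OF w, of "(z, 0)"] that assms by (cases w) auto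
    moreover have "0 \<le> snd w \<bullet> z" if "z \<in> B" for z
      using dual_coneD[OF w, of "(0, z)"] that assms by (cases w) auto
    ultimately show "w \<in> dual_cone A \<times> dual_cone B"
      by (cases w) (auto simp: dual_cone_def)
  qed
qed (auto simp: dual_cone_def)

lemma dual_cone_nonneg_vec: "dual_cone {v :: real^'r. 0 \<le> v} = {v. 0 \<le> v}"
proof
  show "dual_cone {v :: real^'r. 0 \<le> v} \<subseteq> {v. 0 \<le> v}"
  proof
    fix w :: "real^'r" assume w: "w \<in> dual_cone {v. 0 \<le> v}"
    have "0 \<le> w $ i" for i
      using dual_coneD[OF w, of "axis i 1"]
      by (simp add: inner_axis less_eq_vec_def) (simp add: axis_def)
    then show "w \<in> {v. 0 \<le> v}"
      by (simp add: less_eq_vec_def)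
  qed
qed (auto simp: dual_cone_def inner_vec_def less_eq_vec_def intro!: sum_nonneg)

lemma dual_cone_nonneg_real: "dual_cone {0 :: real..} = {0..}"
proof
  show "dual_cone {0 :: real..} \<subseteq> {0..}"
    using dual_coneD[of _ "{0 :: real..}" 1] by force
qed (auto simp: dual_cone_def)

text \<open>The bipolar theorem: a point outside \<open>C\<close> is strictly separated from it, and
  scaling inside the cone forces the separating functional to be nonnegative on \<open>C\<close>,
  hence into the dual cone.\<close>

lemma dual_cone_dual_cone:
  fixes C :: "'b::euclidean_space set"
  assumes "closed C" and C: "convex_cone C"
  shows "dual_cone (dual_cone C) = C"
proof
  show "dual_cone (dual_cone C) \<subseteq> C"
  proof
    fix z assume z: "z \<in> dual_cone (dual_cone C)"
    show "z \<in> C"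
    proof (rule ccontr)
      assume "z \<notin> C"
      then obtain a b where az: "a \<bullet> z < b" and ac: "\<And>c. c \<in> C \<Longrightarrow> b < a \<bullet> c"
        using separating_hyperplane_closed_point[of C z] assms by (auto simp: convex_cone_def)
      have "b < 0"
        using ac[of 0] C by (simp add: convex_cone_contains_0)
      have "0 \<le> a \<bullet> c" if "c \<in> C" for c
      proof (rule ccontr)
        assume neg: "\<not> 0 \<le> a \<bullet> c"
        have "b < a \<bullet> ((b / (a \<bullet> c)) *\<^sub>R c)"
          using neg \<open>b < 0\<close> that C by (intro ac convex_cone_scaleR) (auto simp: divide_nonpos_nonpos)
        then show False
          using neg by simp
      qed
      then have "a \<in> dual_cone C"
        by (simp add: dual_cone_def)
      then show False
        using z az \<open>b < 0\<close> dual_coneD[OF z] by (fastforce simp: inner_commute)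
    qed
  qed
qed (auto simp: dual_cone_def inner_commute)

lemma convex_cone_Times: "convex_cone A \<Longrightarrow> convex_cone B \<Longrightarrow> convex_cone (A \<times> B)"
  by (auto simp: convex_cone_iff zero_prod_def)

lemma dual_cone_Times3:
  assumes "convex_cone A" "convex_cone B" "convex_cone C"
  shows "dual_cone (A \<times> B \<times> C) = dual_cone A \<times> dual_cone B \<times> dual_cone C"
proof -
  have "0 \<in> A" "0 \<in> B" "0 \<in> C" "0 \<in> B \<times> C"
    using assms convex_cone_Times[of B C] by (simp_all only: convex_cone_contains_0)
  then show ?thesis
    by (simp only: dual_cone_Times)
qed

lemma convex_cone_nonneg_real: "convex_cone {0 :: real..}"
  by (auto simp: convex_cone_iff)

text \<open>
  Without the surjectivity hypothesis the multipliers would only represent the valid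
  inequalities up to closure, even under a small loss in the right-hand side.
\<close>

lemma conic_farkas:
  fixes L :: "'a::euclidean_space \<Rightarrow> 'b::euclidean_space"
  assumes "closed C" and C: "convex_cone C" and L: "linear L" and Lt: "linear Lt"
    and adj: "\<And>z w. Lt w \<bullet> z = w \<bullet> L z"
    and surj: "\<And>d. \<exists>w\<in>dual_cone C. Lt w = d"
    and valid: "\<And>z. L z - b \<in> C \<Longrightarrow> t < a \<bullet> z"
  obtains w where "w \<in> dual_cone C" "Lt w = a" "t \<le> w \<bullet> b"
proof -
  \<comment> \<open>All pairs (a, t) for which some multiplier certifies a \<bullet> z \<ge> t; the
    slack \<open>s\<close> allows the right-hand side to be lowered.\<close>
  define G where "G = (\<lambda>(w, s). (Lt w, w \<bullet> b - s)) ` (dual_cone C \<times> {0 :: real..})"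
  have "linear (\<lambda>(w, s). (Lt w, w \<bullet> b - s))"
    using Lt by (auto simp: linear_iff case_prod_beta algebra_simps inner_add_left)
  moreover have "convex_cone (dual_cone C \<times> {0 :: real..})"
    by (intro convex_cone_Times convex_cone_dual_cone convex_cone_nonneg_real)
  ultimately have G: "convex_cone G"
    unfolding G_def by (simp add: convex_cone_linear_image)
  have "(a, t) \<in> G"
  proof (rule ccontr)
    assume "(a, t) \<notin> G"
    then have "\<exists>n c. n \<noteq> 0 \<and> (\<forall>g\<in>{(a, t)}. n \<bullet> g \<le> c) \<and> (\<forall>g\<in>G. c \<le> n \<bullet> g)"
      using G by (intro separating_hyperplane_sets) (auto simp only: convex_cone_def convex_singleton)
    then obtain n c where n0: "n \<noteq> 0" and n1: "n \<bullet> (a, t) \<le> c" and n2: "\<And>g. g \<in> G \<Longrightarrow> c \<le> n \<bullet> g"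
      by blast
    obtain z m where n: "n = (z, m)"
      by (cases n)
    have "c \<le> 0"
      using n2[of 0] convex_cone_contains_0[OF G] by simp
    have G_nonneg: "0 \<le> n \<bullet> g" if "g \<in> G" for g
    proof (rule ccontr)
      assume neg: "\<not> 0 \<le> n \<bullet> g"
      \<comment> \<open>The factor moves the value of the functional to \<open>c - 1\<close>, below
        its lower bound \<open>c\<close> on the cone.\<close>
      have "c \<le> n \<bullet> (((c - 1) / (n \<bullet> g)) *\<^sub>R g)"
        using neg that \<open>c \<le> 0\<close> by (intro n2 convex_cone_scaleR G) (auto simp: divide_nonpos_nonpos)
      then show False
        using neg by simp
    qed
    have "m \<le> 0"
    proof -
      have "(0, - 1) \<in> G"
        unfolding G_def
        by (rule image_eqI[of _ _ "(0, 1)"])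
          (use linear_0[OF Lt] convex_cone_contains_0[OF convex_cone_dual_cone, of C] in auto)
      then show ?thesis
        using G_nonneg n by fastforce
    qed
    have "0 \<le> (L z + m *\<^sub>R b) \<bullet> w" if "w \<in> dual_cone C" for w
    proof -
      have "(Lt w, w \<bullet> b) \<in> G"
        unfolding G_def by (rule image_eqI[of _ _ "(w, 0)"]) (use that in auto)
      then show ?thesis
        using G_nonneg[of "(Lt w, w \<bullet> b)"] adj[of w z]
        by (simp add: n inner_add_left inner_add_right inner_commute)
    qed
    then have "L z + m *\<^sub>R b \<in> dual_cone (dual_cone C)"
      by (simp add: dual_cone_def)
    then have mem: "L z + m *\<^sub>R b \<in> C"
      using dual_cone_dual_cone[OF assms(1) C] by simp
    show False
    \<comment> \<open>A vertical hyperplane: \<open>L z\<close> lies in \<open>C\<close>, so a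
      multiplier representing \<open>- z\<close> gives - (z \<bullet> z) \<ge> 0. This is where
      surjectivity enters.\<close>
    proof (cases "m = 0")
      case True
      obtain w where "w \<in> dual_cone C" "Lt w = - z"
        using surj by blast
      then have "0 \<le> - z \<bullet> z"
        using adj[of w z] dual_coneD[of w C "L z"] mem True by simp
      then have "z = 0"
        by (metis inner_eq_zero_iff inner_ge_zero inner_minus_left neg_0_le_iff_le order_antisym)
      then show False
        using n n0 True by (simp add: zero_prod_def)
    next
      case False
      then have "m < 0"
        using \<open>m \<le> 0\<close> by simp
      \<comment> \<open>Dehomogenizing gives a feasible point, at which strict validity contradicts
        the weak separation \<open>n1\<close>.\<close>
      have "(1 / - m) *\<^sub>R (L z + m *\<^sub>R b) \<in> C"
        using \<open>m < 0\<close> by (intro convex_cone_scaleR C mem) auto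
      moreover have "(1 / - m) *\<^sub>R (L z + m *\<^sub>R b) = L ((1 / - m) *\<^sub>R z) - b"
        using \<open>m < 0\<close> by (simp add: linear_cmul[OF L] linear_neg[OF L] scaleR_right_distrib)
      ultimately have "t < a \<bullet> ((1 / - m) *\<^sub>R z)"
        using valid by metis
      then have "0 < z \<bullet> a + m * t"
        using \<open>m < 0\<close> by (simp add: field_simps inner_commute)
      then show False
        using n1 \<open>c \<le> 0\<close> n by simp
    qed
  qed
  then show thesis
    using that by (auto simp: G_def)
qed

section \<open>The orthant and the second-order cones\<close>

lemma convex_cone_nonneg_vec: "convex_cone {v :: real^'r. 0 \<le> v}"
  by (auto simp: convex_cone_iff less_eq_vec_def)

lemma closed_nonneg_vec: "closed {v :: real^'r. 0 \<le> v}"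
  by (simp add: less_eq_vec_def closed_Collect_all closed_Collect_le continuous_intros)

lemma closed_std_soc: "closed (std_soc :: (real \<times> (real^'n3) \<times> real) set)"
  unfolding std_soc_def case_prod_beta by (intro closed_Collect_le continuous_intros)

lemma convex_cone_std_soc: "convex_cone (std_soc :: (real \<times> (real^'n3) \<times> real) set)"
proof -
  have "norm (a + c, b + d) \<le> s + t" if "norm (a, b) \<le> s" "norm (c, d) \<le> t"
    for a c :: "real^'n3" and b d s t :: real
    using norm_triangle_ineq[of "(a, b)" "(c, d)"] that by simp
  moreover have "norm (c *\<^sub>R a, c * b) \<le> c * s" if "norm (a, b) \<le> s" "0 \<le> c"
    for a :: "real^'n3" and b c s :: real
    using mult_left_mono[OF that] that norm_scaleR[of c "(a, b)"] by simp
  ultimately show ?thesis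
    by (auto simp: convex_cone_iff std_soc_def zero_prod_def intro: mult_left_mono)
qed

lemma soc_product_closed:
  fixes K :: "(real^'k) set"
  assumes "soc_product K"
  shows "closed K"
proof -
  obtain h :: "'k \<Rightarrow> 'k" where
    K: "K = {z. \<forall>i. h i = i \<longrightarrow> z$i \<ge> sqrt (\<Sum>j | h j = i \<and> j \<noteq> i. (z$j)\<^sup>2)}"
    using assms by (auto simp: soc_product_def)
  show ?thesis
    unfolding K by (intro closed_Collect_all closed_Collect_imp closed_Collect_le continuous_intros) auto
qed

lemma soc_product_convex_cone:
  fixes K :: "(real^'k) set"
  assumes "soc_product K"
  shows "convex_cone K"
proof -
  obtain h :: "'k \<Rightarrow> 'k" where
    "K = {z. \<forall>i. h i = i \<longrightarrow> z$i \<ge> sqrt (\<Sum>j | h j = i \<and> j \<noteq> i. (z$j)\<^sup>2)}"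
    using assms by (auto simp: soc_product_def)
  \<comment> \<open>In the \<open>L2_set\<close> form the triangle inequality and homogeneity of the
    norm apply to each block.\<close>
  then have K: "K = {z. \<forall>i. h i = i \<longrightarrow> L2_set (\<lambda>j. z$j) {j. h j = i \<and> j \<noteq> i} \<le> z$i}"
    by (simp add: L2_set_def)
  have "L2_set (($) (x + y)) J \<le> s + t"
    if "L2_set (\<lambda>j. x$j) J \<le> s" "L2_set (\<lambda>j. y$j) J \<le> t" for x y :: "real^'k" and J s t
    using L2_set_triangle_ineq[of "\<lambda>j. x$j" "\<lambda>j. y$j" J] that by (simp add: L2_set_def)
  moreover have "L2_set (($) (c *\<^sub>R x)) J \<le> c * s"
    if "L2_set (\<lambda>j. x$j) J \<le> s" "0 \<le> c" for x :: "real^'k" and J c s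
    using mult_left_mono[OF that] that(2)
    by (simp add: L2_set_right_distrib) (simp add: L2_set_def)
  ultimately show ?thesis
    by (auto simp: convex_cone_iff K) (simp add: L2_set_def)
qed

text \<open>With u = Q - s the outer entries are (1 + u) / 2 and (1 - u) / 2, whose squares differ
  by exactly u. Membership in the cone therefore says v \<bullet> v \<le> u.\<close>

lemma D_op_in_std_soc_iff: "D_op I y - c_tilde I yh \<in> std_soc \<longleftrightarrow> q_obj I y \<le> q_obj I yh"
proof -
  define v where "v = V_obj I *v y"
  define s where "s = g_obj I \<bullet> y"
  define Q where "Q = q_obj I yh"
  have q: "q_obj I y = v \<bullet> v + s"
    by (simp add: q_obj_def v_def s_def matrix_vector_mul_assoc[symmetric] dot_lmul_matrix[symmetric]
        inner_commute)
  have "D_op I y - c_tilde I yh = ((1 + Q - s) / 2, v, (1 - Q + s) / 2)"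
    by (simp add: D_op_def c_tilde_def v_def s_def Q_def field_simps)
  then have "D_op I y - c_tilde I yh \<in> std_soc \<longleftrightarrow>
      sqrt (v \<bullet> v + ((1 - Q + s) / 2)\<^sup>2) \<le> (1 + Q - s) / 2"
    by (simp add: std_soc_def norm_Pair power2_norm_eq_inner)
  also have "\<dots> \<longleftrightarrow> v \<bullet> v + s \<le> Q"
  proof
    assume "sqrt (v \<bullet> v + ((1 - Q + s) / 2)\<^sup>2) \<le> (1 + Q - s) / 2"
    then have "v \<bullet> v + ((1 - Q + s) / 2)\<^sup>2 \<le> ((1 + Q - s) / 2)\<^sup>2"
      by (rule sqrt_le_D)
    then show "v \<bullet> v + s \<le> Q"
      by (simp add: power2_eq_square field_simps)
  next
    assume le: "v \<bullet> v + s \<le> Q"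
    show "sqrt (v \<bullet> v + ((1 - Q + s) / 2)\<^sup>2) \<le> (1 + Q - s) / 2"
    proof (rule real_le_lsqrt)
      \<comment> \<open>Since v \<bullet> v \<ge> 0, the inequality \<open>le\<close> already gives
        s \<le> Q.\<close>
      show "0 \<le> (1 + Q - s) / 2"
        using order_trans[OF add_increasing[OF inner_ge_zero order_refl] le] by simp
      show "v \<bullet> v + ((1 - Q + s) / 2)\<^sup>2 \<le> ((1 + Q - s) / 2)\<^sup>2"
        using le by (simp add: power2_eq_square field_simps)
    qed
  qed
  finally show ?thesis
    using q Q_def by simp
qed

section \<open>Validity and existence of multipliers\<close>

lemma D_adj_inner: "D_adj I r \<bullet> y = r \<bullet> D_op I y"
  by (cases r) (simp add: D_op_def inner_add_left inner_diff_left dot_lmul_matrix)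

lemma linear_D_adj: "linear (D_adj I)"
  by (rule linearI)
    (auto simp: algebra_simps scaleR_vector_matrix_assoc add_divide_distrib)

lemma linear_D_op: "linear (D_op I)"
  by (rule linearI)
    (auto simp: D_op_def algebra_simps inner_add_right matrix_vector_mult_scaleR)

text \<open>The Lagrangian estimate for one disjunct, in homogenized form: \<open>l = 1\<close>
  yields validity of the cut at a point of the disjunct, while the weights \<open>l $ i\<close> of a
  dual solution yield weak duality.\<close>

lemma cg_block_None:
  assumes w: "cg_constraints I Mb Nb hb yh w" and "0 \<le> l"
  shows "l * cg_tau w - cg_alpha w \<bullet> X - cg_beta w \<bullet> Y \<le>
    - (cg_pibar w $ None \<bullet> (Mb *v X + Nb *v Y - l *\<^sub>R hb)
       + cg_pitil w $ None \<bullet> (M_con I *v X + N_con I *v Y - l *\<^sub>R h_con I)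
       + cg_rho w \<bullet> (D_op I Y - l *\<^sub>R c_tilde I yh))"
proof -
  have "cg_tau w \<le> cg_pibar w $ None \<bullet> hb + cg_pitil w $ None \<bullet> h_con I + cg_rho w \<bullet> c_tilde I yh"
    using w by (simp add: cg_constraints_def)
  from mult_left_mono[OF this \<open>0 \<le> l\<close>] have "l * cg_tau w \<le>
      l * (cg_pibar w $ None \<bullet> hb + cg_pitil w $ None \<bullet> h_con I + cg_rho w \<bullet> c_tilde I yh)" .
  moreover have "cg_alpha w \<bullet> X = cg_pibar w $ None \<bullet> (Mb *v X) + cg_pitil w $ None \<bullet> (M_con I *v X)"
    using w by (simp add: cg_constraints_def inner_add_left dot_lmul_matrix)
  moreover have "cg_beta w \<bullet> Y = cg_pibar w $ None \<bullet> (Nb *v Y) + cg_pitil w $ None \<bullet> (N_con I *v Y)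
      + cg_rho w \<bullet> D_op I Y"
  proof -
    have "cg_beta w = cg_pibar w $ None v* Nb + cg_pitil w $ None v* N_con I + D_adj I (cg_rho w)"
      using w by (simp add: cg_constraints_def)
    then show ?thesis
      by (simp add: inner_add_left dot_lmul_matrix D_adj_inner)
  qed
  ultimately show ?thesis
    by (simp add: algebra_simps inner_add_right inner_diff_right)
qed

lemma cg_block_Some:
  assumes w: "cg_constraints I Mb Nb hb yh w" and "0 \<le> l"
  shows "l * cg_tau w - cg_alpha w \<bullet> X - cg_beta w \<bullet> Y \<le>
    - (cg_pibar w $ Some i \<bullet> (Mb *v X + Nb *v Y - l *\<^sub>R hb)
       + cg_pitil w $ Some i \<bullet> (M_con I *v X + N_con I *v Y - l *\<^sub>R h_con I)
       + cg_sigma w $ i * (A_fol I $ i \<bullet> X - l * (f_fol I $ i - 1 - B_fol I $ i \<bullet> yh)))"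
proof -
  have "cg_tau w \<le> cg_pibar w $ Some i \<bullet> hb + cg_pitil w $ Some i \<bullet> h_con I
      + cg_sigma w $ i * (f_fol I $ i - 1 - B_fol I $ i \<bullet> yh)"
    using w by (simp add: cg_constraints_def)
  from mult_left_mono[OF this \<open>0 \<le> l\<close>] have "l * cg_tau w \<le>
      l * (cg_pibar w $ Some i \<bullet> hb + cg_pitil w $ Some i \<bullet> h_con I
      + cg_sigma w $ i * (f_fol I $ i - 1 - B_fol I $ i \<bullet> yh))" .
  moreover have "cg_alpha w \<bullet> X = cg_pibar w $ Some i \<bullet> (Mb *v X)
      + cg_pitil w $ Some i \<bullet> (M_con I *v X) + cg_sigma w $ i * (A_fol I $ i \<bullet> X)"
  proof -
    have "cg_alpha w = cg_pibar w $ Some i v* Mb + cg_pitil w $ Some i v* M_con I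
        + cg_sigma w $ i *\<^sub>R A_fol I $ i"
      using w by (simp add: cg_constraints_def)
    then show ?thesis
      by (simp add: inner_add_left dot_lmul_matrix)
  qed
  moreover have "cg_beta w \<bullet> Y = cg_pibar w $ Some i \<bullet> (Nb *v Y) + cg_pitil w $ Some i \<bullet> (N_con I *v Y)"
  proof -
    have "cg_beta w = cg_pibar w $ Some i v* Nb + cg_pitil w $ Some i v* N_con I"
      using w unfolding cg_constraints_def by blast
    then show ?thesis
      by (simp add: inner_add_left dot_lmul_matrix)
  qed
  ultimately show ?thesis
    by (simp add: algebra_simps inner_add_right inner_diff_right)
qed

lemma inner_nonneg_vec: "0 \<le> v \<Longrightarrow> 0 \<le> w \<Longrightarrow> 0 \<le> v \<bullet> w" for v w :: "real^'n"
  by (simp add: inner_vec_def less_eq_vec_def sum_nonneg)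

text \<open>At a point of the disjunct each multiplier is paired with a slack from the cone to which
  it is dual, so the block estimate with \<open>l = 1\<close> has a nonpositive right-hand
  side.\<close>

lemma cg_constraints_valid:
  assumes w: "cg_constraints I Mb Nb hb yh w" and P: "(x, y) \<in> P_set I Mb Nb hb"
    and i: "disj_cond I yh i (x, y)"
  shows "cg_tau w \<le> cg_alpha w \<bullet> x + cg_beta w \<bullet> y"
proof -
  have pb: "0 \<le> cg_pibar w $ i \<bullet> (Mb *v x + Nb *v y - hb)"
    using w P by (intro inner_nonneg_vec) (auto simp: cg_constraints_def P_set_def)
  have pt: "0 \<le> cg_pitil w $ i \<bullet> (M_con I *v x + N_con I *v y - h_con I)"
    using w P by (intro dual_coneD) (auto simp: cg_constraints_def P_set_def conic_arg_def)
  show ?thesis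
  proof (cases i)
    case None
    have "0 \<le> cg_rho w \<bullet> (D_op I y - c_tilde I yh)"
      using w i None D_op_in_std_soc_iff[of I y yh]
      by (intro dual_coneD[of _ std_soc]) (auto simp: cg_constraints_def)
    then show ?thesis
      using cg_block_None[OF w, of 1 x y] pb pt None by simp
  next
    case (Some j)
    \<comment> \<open>Both factors are nonpositive: \<open>cg_sigma\<close> carries the sign of a
      \<le>-constraint.\<close>
    have "0 \<le> cg_sigma w $ j * (A_fol I $ j \<bullet> x - (f_fol I $ j - 1 - B_fol I $ j \<bullet> yh))"
      using w i Some by (intro mult_nonpos_nonpos) (auto simp: cg_constraints_def less_eq_vec_def)
    then show ?thesis
      using cg_block_Some[OF w, of 1 x y j] pb pt Some by simp
  qed
qed

lemma cg_constraints_separating: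
  assumes w: "cg_constraints I Mb Nb hb yh w" and pos: "0 < cg_objective xs ys w"
  shows "separating_cut (cg_alpha w) (cg_beta w) (cg_tau w) xs ys
    (disj_hull I yh (P_set I Mb Nb hb))"
proof -
  define H where "H = {z. cg_tau w \<le> (cg_alpha w, cg_beta w) \<bullet> z}"
  have "(\<Union>i. {z \<in> P_set I Mb Nb hb. disj_cond I yh i z}) \<subseteq> H"
    using cg_constraints_valid[OF w] by (auto simp: H_def)
  moreover have "convex H"
    using convex_halfspace_ge[of "cg_tau w" "(cg_alpha w, cg_beta w)"] by (simp add: H_def)
  ultimately have "disj_hull I yh (P_set I Mb Nb hb) \<subseteq> H"
    unfolding disj_hull_def by (rule hull_minimal)
  then show ?thesis
    using pos by (auto simp: separating_cut_def H_def cg_objective_def)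
qed

section \<open>Multipliers for a strictly valid inequality\<close>

lemma axis_vector_matrix_mult: "axis r 1 v* A = A $ r" for A :: "real^'n^'m"
  by (simp add: vec_eq_iff vector_matrix_mult_def axis_def if_distrib if_distribR cong: if_cong)

text \<open>The lower and upper bound rows supply all signed unit vectors.\<close>

lemma bound_rows_generate:
  fixes Mb :: "real^'n1::finite^'r::finite" and Nb :: "real^'n2::finite^'r"
  assumes rows: "hpr_relax_rows I \<subseteq> sys_rows Mb Nb hb"
  obtains u where "0 \<le> u" "u v* Mb = d1" "u v* Nb = d2"
proof -
  define T where "T = (\<lambda>u. (u v* Mb, u v* Nb)) ` {u. 0 \<le> u}"
  have "linear (\<lambda>u. (u v* Mb, u v* Nb))"
    by (rule linearI) (auto simp: algebra_simps scaleR_vector_matrix_assoc)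
  then have T: "convex_cone T"
    unfolding T_def by (simp add: convex_cone_linear_image convex_cone_nonneg_vec)
  have row: "(a, b) \<in> T" if mem: "(a, b, t) \<in> hpr_relax_rows I" for a b t
  proof -
    obtain r where "Mb $ r = a" "Nb $ r = b"
      using subsetD[OF rows mem] by (auto simp: sys_rows_def)
    moreover have "axis r 1 v* Mb = Mb $ r" "axis r 1 v* Nb = Nb $ r"
      by (rule axis_vector_matrix_mult)+
    moreover have "0 \<le> (axis r 1 :: real^'r)"
      by (simp add: less_eq_vec_def axis_def)
    ultimately show ?thesis
      unfolding T_def by (intro image_eqI[of _ _ "axis r 1"]) auto
  qed
  have "(axis j 1, 0) \<in> T" for j
    by (rule row[of _ _ "lb_x I $ j"])
      (auto simp: hpr_relax_rows_def sys_rows_def mat_def axis_def vec_eq_iff image_iff)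
  moreover have "(- axis j 1, 0) \<in> T" for j
    by (rule row[of _ _ "- ub_x I $ j"])
      (auto simp: hpr_relax_rows_def sys_rows_def mat_def axis_def vec_eq_iff image_iff)
  moreover have "(0, axis j 1) \<in> T" for j
    by (rule row[of _ _ "lb_y I $ j"])
      (auto simp: hpr_relax_rows_def sys_rows_def mat_def axis_def vec_eq_iff image_iff)
  moreover have "(0, - axis j 1) \<in> T" for j
    by (rule row[of _ _ "- ub_y I $ j"])
      (auto simp: hpr_relax_rows_def sys_rows_def mat_def axis_def vec_eq_iff image_iff)
  ultimately have basis: "b \<in> T" "- b \<in> T" if "b \<in> Basis" for b
    using that by (auto simp: Basis_prod_def Basis_vec_def)
  \<comment> \<open>A negative coefficient is absorbed by \<open>- b\<close>, since \<open>T\<close>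
    is closed under nonnegative scaling only.\<close>
  have coord: "(d \<bullet> b) *\<^sub>R b \<in> T" if "b \<in> Basis" for d b
    using convex_cone_scaleR[OF T, of "d \<bullet> b" b] convex_cone_scaleR[OF T, of "- (d \<bullet> b)" "- b"]
      basis[OF that] by (cases "0 \<le> d \<bullet> b") auto
  have "(\<Sum>b\<in>B. (d \<bullet> b) *\<^sub>R b) \<in> T" if "B \<subseteq> Basis" for d B
    using finite_subset[OF that finite_Basis] that
    by (induction B rule: finite_induct)
      (auto intro!: convex_cone_add[OF T] coord convex_cone_contains_0[OF T])
  from this[of Basis "(d1, d2)"] have "(d1, d2) \<in> T"
    by (simp add: euclidean_representation)
  then show thesis
    using that by (auto simp: T_def)
qed

text \<open>The blocks of the problem share only the cut itself, so the conic Farkas lemma is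
  applied to each disjunct separately with the same inequality and the resulting multipliers are
  stacked.\<close>

lemma cg_constraints_exists:
  fixes I :: "('n1::finite, 'n2::finite, 'n3::finite, 'm1::finite, 'm2::finite, 'k::finite,
               'r2::finite) ibnp"
    and Mb :: "real^'n1^'r::finite" and Nb :: "real^'n2^'r"
  assumes K: "soc_product (K_con I)" and rows: "hpr_relax_rows I \<subseteq> sys_rows Mb Nb hb"
    and valid: "\<And>i x y. (x, y) \<in> P_set I Mb Nb hb \<Longrightarrow> disj_cond I yh i (x, y) \<Longrightarrow>
      \<tau> < \<alpha> \<bullet> x + \<beta> \<bullet> y"
  obtains w where "cg_constraints I Mb Nb hb yh w" "cg_alpha w = \<alpha>" "cg_beta w = \<beta>" "cg_tau w = \<tau>"
proof -
  note Kc = soc_product_convex_cone[OF K]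
  define C0 where "C0 = {v :: real^'r. 0 \<le> v} \<times> K_con I \<times> (std_soc :: (real \<times> (real^'n3) \<times> real) set)"
  have C0: "closed C0" "convex_cone C0"
    unfolding C0_def
    by (intro closed_Times convex_cone_Times closed_nonneg_vec convex_cone_nonneg_vec
        soc_product_closed[OF K] Kc closed_std_soc convex_cone_std_soc)+
  have dual0: "dual_cone C0 = {v. 0 \<le> v} \<times> dual_cone (K_con I) \<times> dual_cone std_soc"
    unfolding C0_def
    by (simp add: dual_cone_Times3 convex_cone_nonneg_vec Kc convex_cone_std_soc dual_cone_nonneg_vec)
  define L0 where "L0 = (\<lambda>(x, y). (Mb *v x + Nb *v y, M_con I *v x + N_con I *v y, D_op I y))"
  define Lt0 where "Lt0 = (\<lambda>w. (fst w v* Mb + fst (snd w) v* M_con I,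
    fst w v* Nb + fst (snd w) v* N_con I + D_adj I (snd (snd w))))"
  obtain w0 where w0: "w0 \<in> dual_cone C0" "Lt0 w0 = (\<alpha>, \<beta>)" "\<tau> \<le> w0 \<bullet> (hb, h_con I, c_tilde I yh)"
  proof (rule conic_farkas[of C0 L0 Lt0 "(hb, h_con I, c_tilde I yh)" \<tau> "(\<alpha>, \<beta>)"])
    show "linear L0"
      unfolding L0_def
      by (rule linearI) (auto simp: algebra_simps linear_add[OF linear_D_op]
          linear_cmul[OF linear_D_op] matrix_vector_mult_scaleR)
    show "linear Lt0"
      unfolding Lt0_def
      by (rule linearI) (auto simp: algebra_simps linear_add[OF linear_D_adj]
          linear_cmul[OF linear_D_adj] scaleR_vector_matrix_assoc simp del: D_adj.simps)
    show "Lt0 w \<bullet> z = w \<bullet> L0 z" for w z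
      by (cases w; cases z)
        (simp add: L0_def Lt0_def inner_add_left inner_add_right dot_lmul_matrix D_adj_inner
            del: D_adj.simps)
    show "\<exists>w\<in>dual_cone C0. Lt0 w = d" for d
    proof -
      obtain u where "0 \<le> u" "u v* Mb = fst d" "u v* Nb = snd d"
        using bound_rows_generate[OF rows] .
      then show ?thesis
        using linear_0[OF linear_D_adj, of I]
        \<comment> \<open>The linear rows alone represent \<open>d\<close>, so the conic multipliers
          may be zero.\<close>
        by (intro bexI[of _ "(u, 0, 0)"])
          (auto simp: Lt0_def dual0 convex_cone_contains_0[OF convex_cone_dual_cone])
    qed
    show "\<tau> < (\<alpha>, \<beta>) \<bullet> z" if "L0 z - (hb, h_con I, c_tilde I yh) \<in> C0" for z
      using that valid[of "fst z" "snd z" None]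
      by (cases z) (auto simp: L0_def C0_def P_set_def conic_arg_def D_op_in_std_soc_iff)
  qed (use C0 in auto)
  \<comment> \<open>The half-line replaces the second-order cone for the linear disjuncts. Its
    constraint is the negated \<le>-inequality, so its multiplier is minus an entry of
    \<open>cg_sigma\<close>.\<close>
  define C1 where "C1 = {v :: real^'r. 0 \<le> v} \<times> K_con I \<times> {0 :: real..}"
  have C1: "closed C1" "convex_cone C1"
    unfolding C1_def
    by (intro closed_Times convex_cone_Times closed_nonneg_vec convex_cone_nonneg_vec
        soc_product_closed[OF K] Kc closed_atLeast convex_cone_nonneg_real)+
  have dual1: "dual_cone C1 = {v. 0 \<le> v} \<times> dual_cone (K_con I) \<times> {0..}"
    unfolding C1_def
    by (simp add: dual_cone_Times3 convex_cone_nonneg_vec Kc convex_cone_nonneg_real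
        dual_cone_nonneg_vec dual_cone_nonneg_real)
  have "\<exists>w. w \<in> dual_cone C1 \<and>
      \<alpha> = fst w v* Mb + fst (snd w) v* M_con I + (- snd (snd w)) *\<^sub>R A_fol I $ i \<and>
      \<beta> = fst w v* Nb + fst (snd w) v* N_con I \<and>
      \<tau> \<le> fst w \<bullet> hb + fst (snd w) \<bullet> h_con I + (- snd (snd w)) * (f_fol I $ i - 1 - B_fol I $ i \<bullet> yh)" for i
  proof -
    define L1 where "L1 = (\<lambda>(x, y). (Mb *v x + Nb *v y, M_con I *v x + N_con I *v y, - (A_fol I $ i \<bullet> x)))"
    define Lt1 where "Lt1 = (\<lambda>(u, k, s). (u v* Mb + k v* M_con I + (- s) *\<^sub>R A_fol I $ i, u v* Nb + k v* N_con I))"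
    define b1 where "b1 = (hb, h_con I, - (f_fol I $ i - 1 - B_fol I $ i \<bullet> yh))"
    obtain w where "w \<in> dual_cone C1" "Lt1 w = (\<alpha>, \<beta>)" "\<tau> \<le> w \<bullet> b1"
    proof (rule conic_farkas[of C1 L1 Lt1 b1 \<tau> "(\<alpha>, \<beta>)"])
      show "linear L1"
        unfolding L1_def
        by (rule linearI) (auto simp: algebra_simps inner_add_right matrix_vector_mult_scaleR)
      show "linear Lt1"
        unfolding Lt1_def
        by (rule linearI) (auto simp: algebra_simps scaleR_vector_matrix_assoc)
      show "Lt1 w \<bullet> z = w \<bullet> L1 z" for w z
        by (cases w; cases z)
          (simp add: L1_def Lt1_def inner_add_left inner_diff_left inner_add_right dot_lmul_matrix)
      show "\<exists>w\<in>dual_cone C1. Lt1 w = d" for d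
      proof -
        obtain u where "0 \<le> u" "u v* Mb = fst d" "u v* Nb = snd d"
          using bound_rows_generate[OF rows] .
        then show ?thesis
          by (intro bexI[of _ "(u, 0, 0)"])
            (auto simp: Lt1_def dual1 convex_cone_contains_0[OF convex_cone_dual_cone])
      qed
      show "\<tau> < (\<alpha>, \<beta>) \<bullet> z" if "L1 z - b1 \<in> C1" for z
        using that valid[of "fst z" "snd z" "Some i"]
        by (cases z) (auto simp: L1_def b1_def C1_def P_set_def conic_arg_def)
    qed (use C1 in auto)
    then show ?thesis
      by (intro exI[of _ w]) (auto simp: Lt1_def b1_def case_prod_beta inner_prod_def right_diff_distrib)
  qed
  then obtain W where W: "\<And>i. W i \<in> dual_cone C1 \<and>
      \<alpha> = fst (W i) v* Mb + fst (snd (W i)) v* M_con I + (- snd (snd (W i))) *\<^sub>R A_fol I $ i \<and>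
      \<beta> = fst (W i) v* Nb + fst (snd (W i)) v* N_con I \<and>
      \<tau> \<le> fst (W i) \<bullet> hb + fst (snd (W i)) \<bullet> h_con I
        + (- snd (snd (W i))) * (f_fol I $ i - 1 - B_fol I $ i \<bullet> yh)"
    by metis
  define w where "w = \<lparr>cg_alpha = \<alpha>, cg_beta = \<beta>, cg_tau = \<tau>,
    cg_pibar = (\<chi> i. case i of None \<Rightarrow> fst w0 | Some j \<Rightarrow> fst (W j)),
    cg_pitil = (\<chi> i. case i of None \<Rightarrow> fst (snd w0) | Some j \<Rightarrow> fst (snd (W j))),
    cg_sigma = (\<chi> j. - snd (snd (W j))), cg_rho = snd (snd w0)\<rparr>"
  have "cg_constraints I Mb Nb hb yh w"
    unfolding cg_constraints_def w_def cg_point.simps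
  proof (intro conjI allI)
    fix i :: "'m2 option"
    show "0 \<le> (\<chi> i. case i of None \<Rightarrow> fst w0 | Some j \<Rightarrow> fst (W j)) $ i"
      using w0(1) W by (cases i) (auto simp: dual0 dual1 mem_Times_iff)
    show "(\<chi> i. case i of None \<Rightarrow> fst (snd w0) | Some j \<Rightarrow> fst (snd (W j))) $ i \<in> dual_cone (K_con I)"
      using w0(1) W by (cases i) (auto simp: dual0 dual1 mem_Times_iff)
  next
    show "(\<chi> j. - snd (snd (W j))) \<le> 0"
      using W by (auto simp: dual1 mem_Times_iff less_eq_vec_def)
  qed (use w0 W in \<open>auto simp: dual0 Lt0_def case_prod_beta inner_prod_def mem_Times_iff\<close>)
  then show thesis
    using that by (simp add: w_def)
qed

section \<open>Attainment of the optimum\<close>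

lemma sum_UNIV_option: "(\<Sum>i\<in>UNIV. f i) = f None + (\<Sum>j\<in>UNIV. f (Some j))"
  for f :: "'i::finite option \<Rightarrow> 'a::comm_monoid_add"
  by (simp add: UNIV_option_conv sum.reindex)

lemma pnorm_nonneg: "0 \<le> pnorm p v"
  \<comment> \<open>For \<open>p = 0\<close> the value is 0, because \<open>root 0\<close> is
    constantly 0.\<close>
  by (cases "p = 0") (auto simp: pnorm_def intro!: real_root_ge_zero sum_nonneg)

lemma pnorm_scaleR:
  assumes "0 < p" "0 \<le> c"
  shows "pnorm p (c *\<^sub>R v) = c * pnorm p v"
  using assms
  by (simp add: pnorm_def abs_mult power_mult_distrib sum_distrib_left[symmetric] real_root_mult
      real_root_power_cancel)

lemma continuous_on_pnorm [continuous_intros]: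
  "continuous_on S f \<Longrightarrow> continuous_on S (\<lambda>x. pnorm p (f x))"
  unfolding pnorm_def by (intro continuous_intros)

lemma continuous_on_vector_matrix_mult [continuous_intros]:
  fixes A :: "real^'n^'m"
  assumes "continuous_on S f"
  shows "continuous_on S (\<lambda>x. f x v* A)"
proof -
  have "linear (\<lambda>x. x v* A)"
    by (rule linearI) (auto simp: algebra_simps scaleR_vector_matrix_assoc)
  then show ?thesis
    using bounded_linear.continuous_on[OF _ assms] by (simp add: linear_conv_bounded_linear)
qed

lemma continuous_on_D_adj [continuous_intros]:
  "continuous_on S f \<Longrightarrow> continuous_on S (\<lambda>x. D_adj I (f x))"
  by (rule bounded_linear.continuous_on[OF linear_D_adj[unfolded linear_conv_bounded_linear]])

text \<open>On the unit vectors of \<open>T\<close>, a compact set, the functional has a positive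
  minimum m; by homogeneity norm v \<le> \<bar>\<theta>\<bar> / m on the slice.\<close>

lemma bounded_cone_slice:
  fixes T :: "'a::euclidean_space set"
  assumes "closed T" "conic T" and pos: "\<And>v. v \<in> T \<Longrightarrow> v \<bullet> u \<le> 0 \<Longrightarrow> v = 0"
  shows "bounded {v \<in> T. v \<bullet> u \<le> \<theta>}"
\<comment> \<open>A minimum exists only over a nonempty set; otherwise \<open>T\<close> contains no
  nonzero vector.\<close>
proof (cases "T \<inter> sphere 0 1 = {}")
  case True
  have "v = 0" if "v \<in> T" for v
  proof (rule ccontr)
    assume "v \<noteq> 0"
    then have "(1 / norm v) *\<^sub>R v \<in> T \<inter> sphere 0 1"
      using assms(2) that by (auto simp: conic_def)
    then show False
      using True by blast
  qed
  then have "{v \<in> T. v \<bullet> u \<le> \<theta>} \<subseteq> {0}"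
    by blast
  then show ?thesis
    by (meson bounded_insert bounded_empty bounded_subset)
next
  case False
  have "compact (T \<inter> sphere 0 1)"
    using assms(1) by (simp add: closed_Int_compact)
  moreover have "continuous_on (T \<inter> sphere 0 1) (\<lambda>v. v \<bullet> u)"
    by (intro continuous_intros)
  ultimately obtain v0 where v0: "v0 \<in> T \<inter> sphere 0 1" and min: "\<And>v. v \<in> T \<inter> sphere 0 1 \<Longrightarrow> v0 \<bullet> u \<le> v \<bullet> u"
    using continuous_attains_inf[OF _ False] by blast
  then have m: "0 < v0 \<bullet> u"
    using pos[of v0] by (cases "v0 \<bullet> u \<le> 0") auto
  have "norm v \<le> \<bar>\<theta>\<bar> / (v0 \<bullet> u)" if "v \<in> T" "v \<bullet> u \<le> \<theta>" for v
  proof (cases "v = 0")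
    case True
    then show ?thesis
      using m by simp
  next
    case False
    then have "(1 / norm v) *\<^sub>R v \<in> T \<inter> sphere 0 1"
      using assms(2) that by (auto simp: conic_def)
    from min[OF this] have "(v0 \<bullet> u) * norm v \<le> v \<bullet> u"
      using False by (simp add: field_simps)
    then show ?thesis
      using m that(2) by (simp add: field_simps)
  qed
  then show ?thesis
    by (auto simp: bounded_iff)
qed

lemma interior_nonneg_vec:
  assumes "\<And>j. 0 < v $ j"
  shows "v \<in> interior {v :: real^'r. 0 \<le> v}"
proof (rule interiorI)
  have "open (\<Inter>j. {v :: real^'r. 0 < v $ j})"
    by (intro open_INT ballI open_Collect_less continuous_intros) auto
  then show "open {v :: real^'r. \<forall>j. 0 < v $ j}"
    by (simp add: Collect_all_eq)
qed (use assms in \<open>auto simp: less_eq_vec_def intro: less_imp_le\<close>)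

text \<open>The sum of the block estimates, with weights \<open>l\<close> adding up to one. The
  parts \<open>sa\<close> and \<open>sb\<close> remain on the left because only the normalization
  can account for them.\<close>

lemma cg_weak_duality:
  assumes w: "cg_constraints I Mb Nb hb yh w"
    and X: "(\<Sum>i\<in>UNIV. X $ i) = xs - sa" and Y: "(\<Sum>i\<in>UNIV. Y $ i) = ys - sb"
    and l: "(\<Sum>i\<in>UNIV. l $ i) = 1" "\<And>i. 0 \<le> l $ i"
  shows "cg_objective xs ys w + cg_alpha w \<bullet> sa + cg_beta w \<bullet> sb \<le>
    - ((\<Sum>i\<in>UNIV. cg_pibar w $ i \<bullet> (Mb *v X $ i + Nb *v Y $ i - l $ i *\<^sub>R hb))
      + (\<Sum>i\<in>UNIV. cg_pitil w $ i \<bullet> (M_con I *v X $ i + N_con I *v Y $ i - l $ i *\<^sub>R h_con I))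
      + (\<Sum>i\<in>UNIV. cg_sigma w $ i *
          (A_fol I $ i \<bullet> X $ Some i - l $ Some i * (f_fol I $ i - 1 - B_fol I $ i \<bullet> yh)))
      + cg_rho w \<bullet> (D_op I (Y $ None) - l $ None *\<^sub>R c_tilde I yh))"
proof -
  define g where "g i = l $ i * cg_tau w - cg_alpha w \<bullet> X $ i - cg_beta w \<bullet> Y $ i" for i
  have "cg_alpha w \<bullet> xs = cg_alpha w \<bullet> (\<Sum>i\<in>UNIV. X $ i) + cg_alpha w \<bullet> sa"
    by (simp add: X inner_diff_right)
  moreover have "cg_beta w \<bullet> ys = cg_beta w \<bullet> (\<Sum>i\<in>UNIV. Y $ i) + cg_beta w \<bullet> sb"
    by (simp add: Y inner_diff_right)
  moreover have "cg_tau w = (\<Sum>i\<in>UNIV. l $ i * cg_tau w)"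
    by (simp add: sum_distrib_right[symmetric] l)
  ultimately have "cg_objective xs ys w + cg_alpha w \<bullet> sa + cg_beta w \<bullet> sb = (\<Sum>i\<in>UNIV. g i)"
    by (simp add: cg_objective_def g_def sum_subtractf inner_sum_right)
  also have "\<dots> = g None + (\<Sum>j\<in>UNIV. g (Some j))"
    by (rule sum_UNIV_option)
  also have "\<dots> \<le> - (cg_pibar w $ None \<bullet> (Mb *v X $ None + Nb *v Y $ None - l $ None *\<^sub>R hb)
       + cg_pitil w $ None \<bullet> (M_con I *v X $ None + N_con I *v Y $ None - l $ None *\<^sub>R h_con I)
       + cg_rho w \<bullet> (D_op I (Y $ None) - l $ None *\<^sub>R c_tilde I yh))
    + (\<Sum>j\<in>UNIV. - (cg_pibar w $ Some j \<bullet> (Mb *v X $ Some j + Nb *v Y $ Some j - l $ Some j *\<^sub>R hb)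
       + cg_pitil w $ Some j \<bullet> (M_con I *v X $ Some j + N_con I *v Y $ Some j - l $ Some j *\<^sub>R h_con I)
       + cg_sigma w $ j * (A_fol I $ j \<bullet> X $ Some j - l $ Some j * (f_fol I $ j - 1 - B_fol I $ j \<bullet> yh))))"
    unfolding g_def by (intro add_mono sum_mono cg_block_None cg_block_Some w l)
  finally show ?thesis
    by (simp add: sum_UNIV_option sum.distrib sum_negf sum_subtractf)
qed

text \<open>The normalization puts (1, v) into \<open>norm_cone p\<close>, and the dual solution
  pairs nonnegatively with it. The parts of s outside the norm are zero, so one formula serves all
  three normalizations.\<close>

lemma cg_normalized_dual:
  assumes "dual_norm_strict nrm p \<theta> sa sb spb spt ss sr" and "cg_normalized nrm p w"
  shows "0 \<le> \<theta> + cg_alpha w \<bullet> sa + cg_beta w \<bullet> sb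
    + cg_pibar w \<bullet> spb + cg_pitil w \<bullet> spt + cg_sigma w \<bullet> ss + cg_rho w \<bullet> sr"
proof -
  have *: "0 \<le> \<theta> + s \<bullet> v" if "(\<theta>, s) \<in> interior (dual_cone (norm_cone p))" "pnorm p v \<le> 1"
    for s v :: "'z::euclidean_space"
    using dual_coneD[of "(\<theta>, s)" "norm_cone p" "(1, v)"] that interior_subset
    by (auto simp: norm_cone_def)
  show ?thesis
    using assms by (cases nrm) (auto dest!: * simp: inner_commute add.assoc)
qed

text \<open>Only the sign and cone conditions are kept; the equations and the inequalities on \<tau>
  enter the bound through weak duality.\<close>

definition multiplier_cone ::
  "(real^'k) set \<Rightarrow> ((real^'r^'m2 option) \<times> (real^'k^'m2 option) \<times> (real^'m2::finite) \<times>
    real \<times> (real^'n3) \<times> real) set" where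
  "multiplier_cone K = {(pb, pt, s, r).
     (\<forall>i. 0 \<le> pb $ i \<and> pt $ i \<in> dual_cone K) \<and> s \<le> 0 \<and> r \<in> dual_cone std_soc}"

lemma closed_multiplier_cone: "closed (multiplier_cone K)"
  unfolding multiplier_cone_def case_prod_beta less_eq_vec_def
  by (intro closed_Collect_conj closed_Collect_all closed_Collect_le closed_Collect_dual_cone
      continuous_intros)

lemma conic_multiplier_cone:
  "conic (multiplier_cone K :: ((real^'a^'b option) \<times> (real^'k^'b option) \<times> (real^'b) \<times>
    real \<times> (real^'c) \<times> real) set)"
  unfolding conic_def
proof (intro allI impI)
  fix v :: "(real^'a^'b option) \<times> (real^'k^'b option) \<times> (real^'b) \<times> real \<times> (real^'c) \<times> real"
    and c :: real
  assume v: "v \<in> multiplier_cone K" and c: "0 \<le> c"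
  obtain pb pt s r where [simp]: "v = (pb, pt, s, r)"
    by (cases v rule: prod_cases4)
  have "c *\<^sub>R r \<in> dual_cone std_soc" "c *\<^sub>R pt $ i \<in> dual_cone K" for i
    using v c by (auto simp: multiplier_cone_def intro!: convex_cone_scaleR convex_cone_dual_cone)
  moreover have "0 \<le> c *\<^sub>R pb $ i" "c *\<^sub>R s \<le> 0" for i
    using v c by (auto simp: multiplier_cone_def less_eq_vec_def mult_nonneg_nonpos)
  ultimately show "c *\<^sub>R v \<in> multiplier_cone K"
    by (simp add: multiplier_cone_def)
qed

text \<open>The pairing is a sum of nonnegative products, so a nonpositive total makes each product
  zero, and a multiplier orthogonal to an interior point of its cone vanishes. The \<open>s\<close>
  part is negated to fit this pattern.\<close>

lemma multiplier_cone_interior: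
  assumes v: "(pb, pt, s, r) \<in> multiplier_cone K"
    and pos: "\<And>i j. 0 < upb $ i $ j" "\<And>i. utl $ i \<in> interior K" "\<And>j. us $ j < 0"
      "ur \<in> interior std_soc"
    and le: "(pb, pt, s, r) \<bullet> (upb, utl, us, ur) \<le> 0"
  shows "(pb, pt, s, r) = 0"
proof -
  have dual: "pb $ i \<in> dual_cone {v. 0 \<le> v}" "pt $ i \<in> dual_cone K" "- s \<in> dual_cone {v. 0 \<le> v}"
    "r \<in> dual_cone std_soc" for i
    using v by (auto simp: multiplier_cone_def dual_cone_nonneg_vec)
  have int: "upb $ i \<in> interior {v. 0 \<le> v}" "- us \<in> interior {v. 0 \<le> v}" for i
    using pos by (auto intro: interior_nonneg_vec)
  have "0 \<le> pb $ i \<bullet> upb $ i" "0 \<le> pt $ i \<bullet> utl $ i" "0 \<le> s \<bullet> us" "0 \<le> r \<bullet> ur" for i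
    using dual_coneD[OF dual(1) subsetD[OF interior_subset int(1)], of i i]
      dual_coneD[OF dual(2) subsetD[OF interior_subset pos(2)], of i i]
      dual_coneD[OF dual(3) subsetD[OF interior_subset int(2)]]
      dual_coneD[OF dual(4) subsetD[OF interior_subset pos(4)]]
    by simp_all
  note nonneg = this
  have sums: "0 \<le> pb \<bullet> upb" "0 \<le> pt \<bullet> utl"
    using nonneg by (auto simp: inner_vec_def[of pb] inner_vec_def[of pt] intro!: sum_nonneg)
  have zero: "pb \<bullet> upb = 0" "pt \<bullet> utl = 0" "s \<bullet> us = 0" "r \<bullet> ur = 0"
    using le sums nonneg(3,4) by simp_all
  have "pb $ i \<bullet> upb $ i = 0" "pt $ i \<bullet> utl $ i = 0" for i
    using zero(1,2) nonneg(1,2)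
    by (simp_all add: inner_vec_def[of pb] inner_vec_def[of pt] sum_nonneg_eq_0_iff)
  then have "pb $ i = 0" "pt $ i = 0" for i
    using dual_cone_interior_eq_0[OF dual(1) int(1), of i i]
      dual_cone_interior_eq_0[OF dual(2) pos(2), of i i] by simp_all
  then have "pb = 0" "pt = 0"
    by (simp_all add: vec_eq_iff[of pb] vec_eq_iff[of pt])
  moreover have "s = 0" "r = 0"
    using dual_cone_interior_eq_0[OF dual(3) int(2)] dual_cone_interior_eq_0[OF dual(4) pos(4)] zero
    by simp_all
  ultimately show ?thesis
    by (simp add: zero_prod_def)
qed

section \<open>Boundedness of the multipliers\<close>

definition cg_mult ::
  "('n1::finite, 'n2::finite, 'n3::finite, 'm2::finite, 'k::finite, 'r::finite) cg_point
    \<Rightarrow> (real^'r^'m2 option) \<times> (real^'k^'m2 option) \<times> (real^'m2) \<times> real \<times> (real^'n3) \<times> real" where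
  "cg_mult w = (cg_pibar w, cg_pitil w, cg_sigma w, cg_rho w)"

lemma cg_mult_bounded:
  fixes I :: "('n1::finite, 'n2::finite, 'n3::finite, 'm1::finite, 'm2::finite, 'k::finite,
               'r2::finite) ibnp"
    and Mb :: "real^'n1^'r::finite" and Nb :: "real^'n2^'r"
  assumes dual: "cg_dual_strictly_feasible I Mb Nb hb xs ys yh nrm p"
  shows "bounded (cg_mult ` {w. cg_feasible I Mb Nb hb yh nrm p w \<and> 0 \<le> cg_objective xs ys w})"
proof -
  obtain X Y and l :: "real^'m2 option" and \<theta> sa sb spb spt ss sr where
    X: "(\<Sum>i\<in>UNIV. X $ i) = xs - sa" and Y: "(\<Sum>i\<in>UNIV. Y $ i) = ys - sb"
    and l: "(\<Sum>i\<in>UNIV. l $ i) = 1" "\<And>i. l $ i > 0"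
    and pb: "\<And>i j. (Mb *v X $ i + Nb *v Y $ i - l $ i *\<^sub>R hb - spb $ i) $ j > 0"
    and pt: "\<And>i. M_con I *v X $ i + N_con I *v Y $ i - l $ i *\<^sub>R h_con I - spt $ i
               \<in> interior (K_con I)"
    and s: "\<And>i. A_fol I $ i \<bullet> X $ Some i - l $ Some i * (f_fol I $ i - 1 - B_fol I $ i \<bullet> yh)
               - ss $ i < 0"
    and r: "D_op I (Y $ None) - l $ None *\<^sub>R c_tilde I yh - sr \<in> interior std_soc"
    and norm: "dual_norm_strict nrm p \<theta> sa sb spb spt ss sr"
    using dual unfolding cg_dual_strictly_feasible_def by blast
  \<comment> \<open>The slacks of the strictly feasible dual solution, all interior to their
    cones.\<close>
  define upb where "upb = (\<chi> i. Mb *v X $ i + Nb *v Y $ i - l $ i *\<^sub>R hb - spb $ i)"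
  define utl where "utl = (\<chi> i. M_con I *v X $ i + N_con I *v Y $ i - l $ i *\<^sub>R h_con I - spt $ i)"
  define us where "us = (\<chi> i. A_fol I $ i \<bullet> X $ Some i
    - l $ Some i * (f_fol I $ i - 1 - B_fol I $ i \<bullet> yh) - ss $ i)"
  define ur where "ur = D_op I (Y $ None) - l $ None *\<^sub>R c_tilde I yh - sr"
  \<comment> \<open>Weak duality bounds the pairing by minus the objective and the terms in
    \<open>sa\<close>, \<open>sb\<close>, \<open>spb\<close>, \<open>spt\<close>, \<open>ss\<close>,
    \<open>sr\<close>; the normalization bounds minus those terms by \<theta>, and the objective is
    nonnegative.\<close>
  have le: "cg_mult w \<bullet> (upb, utl, us, ur) \<le> \<theta>"
    if w: "cg_feasible I Mb Nb hb yh nrm p w" "0 \<le> cg_objective xs ys w" for w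
  proof -
    have "cg_pibar w \<bullet> upb = (\<Sum>i\<in>UNIV. cg_pibar w $ i \<bullet> (Mb *v X $ i + Nb *v Y $ i - l $ i *\<^sub>R hb))
        - cg_pibar w \<bullet> spb"
      by (simp add: upb_def inner_vec_def[of "cg_pibar w"] inner_diff_right sum_subtractf)
    moreover have "cg_pitil w \<bullet> utl = (\<Sum>i\<in>UNIV. cg_pitil w $ i \<bullet>
        (M_con I *v X $ i + N_con I *v Y $ i - l $ i *\<^sub>R h_con I)) - cg_pitil w \<bullet> spt"
      by (simp add: utl_def inner_vec_def[of "cg_pitil w"] inner_diff_right sum_subtractf)
    moreover have "cg_sigma w \<bullet> us = (\<Sum>i\<in>UNIV. cg_sigma w $ i *
        (A_fol I $ i \<bullet> X $ Some i - l $ Some i * (f_fol I $ i - 1 - B_fol I $ i \<bullet> yh)))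
        - cg_sigma w \<bullet> ss"
      by (simp add: us_def inner_vec_def[of "cg_sigma w"] right_diff_distrib sum_subtractf)
    moreover have "cg_rho w \<bullet> ur = cg_rho w \<bullet> (D_op I (Y $ None) - l $ None *\<^sub>R c_tilde I yh)
        - cg_rho w \<bullet> sr"
      by (simp add: ur_def inner_diff_right)
    moreover have "cg_constraints I Mb Nb hb yh w" "cg_normalized nrm p w"
      using w by (auto simp: cg_feasible_def)
    ultimately show ?thesis
      using cg_weak_duality[of I Mb Nb hb yh w X xs sa Y ys sb l] X Y l less_imp_le[OF l(2)]
        cg_normalized_dual[OF norm, of w] w(2)
      by (simp add: cg_mult_def)
  qed
  have "cg_mult w \<in> multiplier_cone (K_con I)" if "cg_feasible I Mb Nb hb yh nrm p w" for w
    using that by (auto simp: cg_feasible_def cg_constraints_def cg_mult_def multiplier_cone_def)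
  with le have "cg_mult ` {w. cg_feasible I Mb Nb hb yh nrm p w \<and> 0 \<le> cg_objective xs ys w} \<subseteq>
      {v \<in> multiplier_cone (K_con I). v \<bullet> (upb, utl, us, ur) \<le> \<theta>}"
    by blast
  moreover have "bounded {v \<in> multiplier_cone (K_con I). v \<bullet> (upb, utl, us, ur) \<le> \<theta>}"
  proof (intro bounded_cone_slice closed_multiplier_cone conic_multiplier_cone)
    fix v assume v: "v \<in> multiplier_cone (K_con I)" "v \<bullet> (upb, utl, us, ur) \<le> 0"
    obtain a b c d where "v = (a, b, c, d)"
      by (cases v rule: prod_cases4)
    then show "v = 0"
      using multiplier_cone_interior[of a b c d "K_con I" upb utl us ur] v pb pt s r
      by (simp add: upb_def utl_def us_def ur_def)
  qed
  ultimately show ?thesis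
    using bounded_subset by blast
qed

text \<open>The equations of block \<open>None\<close> determine \<alpha> and \<beta>, so feasible
  points are parametrized by multipliers and \<tau>. This moves the problem from records to a
  Euclidean space, where compactness can be used.\<close>

definition cg_of ::
  "('n1::finite, 'n2::finite, 'n3::finite, 'm1::finite, 'm2::finite, 'k::finite, 'r2::finite) ibnp
    \<Rightarrow> real^'n1^'r \<Rightarrow> real^'n2^'r
    \<Rightarrow> ((real^'r^'m2 option) \<times> (real^'k^'m2 option) \<times> (real^'m2) \<times> real \<times> (real^'n3) \<times> real) \<times> real
    \<Rightarrow> ('n1, 'n2, 'n3, 'm2, 'k, 'r::finite) cg_point" where
  "cg_of I Mb Nb t = \<lparr>
     cg_alpha = fst (fst t) $ None v* Mb + fst (snd (fst t)) $ None v* M_con I,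
     cg_beta = fst (fst t) $ None v* Nb + fst (snd (fst t)) $ None v* N_con I
       + D_adj I (snd (snd (snd (fst t)))),
     cg_tau = snd t, cg_pibar = fst (fst t), cg_pitil = fst (snd (fst t)),
     cg_sigma = fst (snd (snd (fst t))), cg_rho = snd (snd (snd (fst t)))\<rparr>"

lemma cg_of_mult:
  assumes "cg_constraints I Mb Nb hb yh w"
  shows "cg_of I Mb Nb (cg_mult w, cg_tau w) = w"
  using assms by (cases w) (simp add: cg_of_def cg_mult_def cg_constraints_def)

lemma cg_mult_of: "cg_mult (cg_of I Mb Nb t) = fst t"
  by (simp add: cg_of_def cg_mult_def)

lemma closed_Collect_normalized:
  assumes "continuous_on UNIV (\<lambda>t. cg_alpha (f t))" "continuous_on UNIV (\<lambda>t. cg_beta (f t))"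
    "continuous_on UNIV (\<lambda>t. cg_pibar (f t))" "continuous_on UNIV (\<lambda>t. cg_pitil (f t))"
    "continuous_on UNIV (\<lambda>t. cg_sigma (f t))" "continuous_on UNIV (\<lambda>t. cg_rho (f t))"
  shows "closed {t. cg_normalized nrm p (f t)}"
  using assms by (cases nrm) (auto intro!: closed_Collect_le continuous_intros)

lemma continuous_on_cg_objective:
  "continuous_on S (\<lambda>t. cg_objective xs ys (cg_of I Mb Nb t))"
  unfolding cg_objective_def cg_of_def cg_point.simps by (intro continuous_intros)

lemma closed_cg_feasible:
  "closed {t. cg_feasible I Mb Nb hb yh nrm p (cg_of I Mb Nb t)}"
  unfolding cg_feasible_def cg_constraints_def less_eq_vec_def
  by (intro closed_Collect_conj closed_Collect_all closed_Collect_normalized closed_Collect_eq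
      closed_Collect_le closed_Collect_dual_cone; simp add: cg_of_def; intro continuous_intros)

text \<open>The set \<open>S\<close> of feasible parameters with nonnegative objective is compact
  and, by \<open>feas\<close>, nonempty. A maximizer on it also beats the feasible points of
  negative objective.\<close>

lemma cg_optimal_exists:
  fixes I :: "('n1::finite, 'n2::finite, 'n3::finite, 'm1::finite, 'm2::finite, 'k::finite,
               'r2::finite) ibnp"
    and Mb :: "real^'n1^'r::finite" and Nb :: "real^'n2^'r"
  assumes dual: "cg_dual_strictly_feasible I Mb Nb hb xs ys yh nrm p"
    and feas: "cg_feasible I Mb Nb hb yh nrm p w0" "0 \<le> cg_objective xs ys w0"
  obtains w where "cg_optimal I Mb Nb hb xs ys yh nrm p w"
proof -
  define obj where "obj t = cg_objective xs ys (cg_of I Mb Nb t)" for t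
  define S where "S = {t. cg_feasible I Mb Nb hb yh nrm p (cg_of I Mb Nb t) \<and> 0 \<le> obj t}"
  have obj: "continuous_on A obj" for A
    using continuous_on_cg_objective unfolding obj_def .
  have "closed S"
    unfolding S_def by (intro closed_Collect_conj closed_cg_feasible closed_Collect_le obj continuous_intros)
  moreover have "bounded S"
  proof -
    define B where "B = cg_mult ` {w. cg_feasible I Mb Nb hb yh nrm p w \<and> 0 \<le> cg_objective xs ys w}"
    have B: "bounded B"
      using cg_mult_bounded[OF dual] by (simp add: B_def)
    \<comment> \<open>The objective is \<tau> minus \<open>lo v\<close>, so nonnegativity bounds
      \<tau> below by \<open>lo v\<close>; \<open>hi v\<close> is the upper bound on \<tau> from
      block \<open>None\<close>.\<close>
    define lo where "lo v = - obj (v, 0)" for v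
    define hi where "hi v = fst v $ None \<bullet> hb + fst (snd v) $ None \<bullet> h_con I
      + snd (snd (snd v)) \<bullet> c_tilde I yh"
      for v :: "(real^'r^'m2 option) \<times> (real^'k^'m2 option) \<times> (real^'m2) \<times> real \<times> (real^'n3) \<times> real"
    have bd: "bounded (f ` B)" if "continuous_on UNIV f" for f :: "_ \<Rightarrow> real"
    proof -
      have "compact (f ` closure B)"
        using B continuous_on_subset[OF that subset_UNIV]
        by (intro compact_continuous_image) auto
      then show ?thesis
        using compact_imp_bounded bounded_subset image_mono[OF closure_subset] by metis
    qed
    have "bounded (lo ` B)"
      unfolding lo_def by (intro bd continuous_intros continuous_on_compose2[OF obj]) auto
    moreover have "bounded (hi ` B)"
      unfolding hi_def by (intro bd continuous_intros)
    ultimately obtain a b where a: "\<And>v. v \<in> B \<Longrightarrow> \<bar>lo v\<bar> \<le> a" and b: "\<And>v. v \<in> B \<Longrightarrow> \<bar>hi v\<bar> \<le> b"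
      unfolding bounded_iff by auto
    have "S \<subseteq> B \<times> {- a..b}"
    proof
      fix t assume t: "t \<in> S"
      have v: "fst t \<in> B"
        unfolding B_def by (rule image_eqI[of _ _ "cg_of I Mb Nb t"])
          (use t in \<open>auto simp: S_def obj_def cg_mult_of\<close>)
      have "snd t = obj t + lo (fst t)"
        by (simp add: lo_def obj_def cg_objective_def cg_of_def)
      moreover have "0 \<le> obj t"
        using t by (simp add: S_def)
      ultimately have "- a \<le> snd t"
        using a[OF v] by linarith
      moreover have "snd t \<le> hi (fst t)"
        using t by (simp add: S_def cg_feasible_def cg_constraints_def) (simp add: hi_def cg_of_def)
      ultimately show "t \<in> B \<times> {- a..b}"
        using v b[OF v] by (auto simp: mem_Times_iff)
    qed
    then show ?thesis
      using B bounded_Times bounded_closed_interval bounded_subset by metis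
  qed
  ultimately have "compact S"
    by (simp add: compact_eq_bounded_closed)
  have in_S: "(cg_mult w, cg_tau w) \<in> S"
    if "cg_feasible I Mb Nb hb yh nrm p w" "0 \<le> cg_objective xs ys w" for w
    using that cg_of_mult[of I Mb Nb hb yh w] by (simp add: S_def obj_def cg_feasible_def)
  have "S \<noteq> {}"
    using in_S[OF feas] by blast
  then obtain t where t: "t \<in> S" and max: "\<And>t'. t' \<in> S \<Longrightarrow> obj t' \<le> obj t"
    using continuous_attains_sup[OF \<open>compact S\<close> _ obj] by metis
  have "cg_objective xs ys w \<le> obj t" if w: "cg_feasible I Mb Nb hb yh nrm p w" for w
  proof (cases "0 \<le> cg_objective xs ys w")
    case True
    have "cg_of I Mb Nb (cg_mult w, cg_tau w) = w"
      using w cg_of_mult by (auto simp: cg_feasible_def)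
    then show ?thesis
      using max[OF in_S[OF w True]] by (simp add: obj_def)
  next
    case False
    then show ?thesis
      using t by (simp add: S_def)
  qed
  then have "cg_optimal I Mb Nb hb xs ys yh nrm p (cg_of I Mb Nb t)"
    using t by (auto simp: cg_optimal_def S_def obj_def)
  then show thesis
    using that by blast
qed

section \<open>Scaling to a normalized point\<close>

definition cg_scale ::
  "real \<Rightarrow> ('n1::finite, 'n2::finite, 'n3::finite, 'm2::finite, 'k::finite, 'r::finite) cg_point
    \<Rightarrow> ('n1, 'n2, 'n3, 'm2, 'k, 'r) cg_point" where
  "cg_scale c w = \<lparr>cg_alpha = c *\<^sub>R cg_alpha w, cg_beta = c *\<^sub>R cg_beta w, cg_tau = c * cg_tau w,
     cg_pibar = c *\<^sub>R cg_pibar w, cg_pitil = c *\<^sub>R cg_pitil w, cg_sigma = c *\<^sub>R cg_sigma w,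
     cg_rho = c *\<^sub>R cg_rho w\<rparr>"

lemma cg_objective_scale: "cg_objective xs ys (cg_scale c w) = c * cg_objective xs ys w"
  by (simp add: cg_objective_def cg_scale_def algebra_simps)

lemma cg_constraints_scale:
  assumes w: "cg_constraints I Mb Nb hb yh w" and c: "0 \<le> c"
  shows "cg_constraints I Mb Nb hb yh (cg_scale c w)"
  unfolding cg_constraints_def cg_scale_def cg_point.simps
proof (intro conjI allI)
  note eqs = w[unfolded cg_constraints_def]
  show "c *\<^sub>R cg_alpha w = (c *\<^sub>R cg_pibar w) $ Some i v* Mb + (c *\<^sub>R cg_pitil w) $ Some i v* M_con I
      + (c *\<^sub>R cg_sigma w) $ i *\<^sub>R A_fol I $ i" for i
  proof -
    have "cg_alpha w = cg_pibar w $ Some i v* Mb + cg_pitil w $ Some i v* M_con I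
        + cg_sigma w $ i *\<^sub>R A_fol I $ i"
      using eqs by blast
    then show ?thesis
      by (simp add: scaleR_vector_matrix_assoc scaleR_add_right)
  qed
  show "c *\<^sub>R cg_alpha w = (c *\<^sub>R cg_pibar w) $ None v* Mb + (c *\<^sub>R cg_pitil w) $ None v* M_con I"
  proof -
    have "cg_alpha w = cg_pibar w $ None v* Mb + cg_pitil w $ None v* M_con I"
      using eqs by blast
    then show ?thesis
      by (simp add: scaleR_vector_matrix_assoc scaleR_add_right)
  qed
  show "c *\<^sub>R cg_beta w = (c *\<^sub>R cg_pibar w) $ Some i v* Nb + (c *\<^sub>R cg_pitil w) $ Some i v* N_con I" for i
  proof -
    have "cg_beta w = cg_pibar w $ Some i v* Nb + cg_pitil w $ Some i v* N_con I"
      using eqs by blast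
    then show ?thesis
      by (simp add: scaleR_vector_matrix_assoc scaleR_add_right)
  qed
  show "c *\<^sub>R cg_beta w = (c *\<^sub>R cg_pibar w) $ None v* Nb + (c *\<^sub>R cg_pitil w) $ None v* N_con I
      + D_adj I (c *\<^sub>R cg_rho w)"
  proof -
    have "cg_beta w = cg_pibar w $ None v* Nb + cg_pitil w $ None v* N_con I + D_adj I (cg_rho w)"
      using eqs by blast
    then show ?thesis
      by (simp add: scaleR_vector_matrix_assoc scaleR_add_right linear_cmul[OF linear_D_adj])
  qed
  show "c * cg_tau w \<le> (c *\<^sub>R cg_pibar w) $ Some i \<bullet> hb + (c *\<^sub>R cg_pitil w) $ Some i \<bullet> h_con I
      + (c *\<^sub>R cg_sigma w) $ i * (f_fol I $ i - 1 - B_fol I $ i \<bullet> yh)" for i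
  proof -
    have "cg_tau w \<le> cg_pibar w $ Some i \<bullet> hb + cg_pitil w $ Some i \<bullet> h_con I
        + cg_sigma w $ i * (f_fol I $ i - 1 - B_fol I $ i \<bullet> yh)"
      using eqs by blast
    from mult_left_mono[OF this c] show ?thesis
      by (simp add: distrib_left mult.assoc)
  qed
  show "c * cg_tau w \<le> (c *\<^sub>R cg_pibar w) $ None \<bullet> hb + (c *\<^sub>R cg_pitil w) $ None \<bullet> h_con I
      + (c *\<^sub>R cg_rho w) \<bullet> c_tilde I yh"
  proof -
    have "cg_tau w \<le> cg_pibar w $ None \<bullet> hb + cg_pitil w $ None \<bullet> h_con I + cg_rho w \<bullet> c_tilde I yh"
      using eqs by blast
    from mult_left_mono[OF this c] show ?thesis
      by (simp add: distrib_left)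
  qed
  show "c *\<^sub>R cg_sigma w \<le> 0"
    using eqs c by (auto simp: less_eq_vec_def mult_nonneg_nonpos)
  show "c *\<^sub>R cg_rho w \<in> dual_cone std_soc"
    using eqs c by (auto intro: convex_cone_scaleR convex_cone_dual_cone)
  show "0 \<le> (c *\<^sub>R cg_pibar w) $ i" for i
    using eqs c by (auto simp: less_eq_vec_def)
  show "(c *\<^sub>R cg_pitil w) $ i \<in> dual_cone (K_con I)" for i
    using eqs c by (auto intro: convex_cone_scaleR convex_cone_dual_cone)
qed

lemma cg_normalized_scale:
  assumes p: "0 < p"
  obtains c where "0 < c" "cg_normalized nrm p (cg_scale c w)"
proof -
  \<comment> \<open>Adding 1 to the norm keeps the factor defined and positive even when all
    normalized variables vanish.\<close>
  have scale: "0 < 1 / (1 + pnorm p v)" "pnorm p ((1 / (1 + pnorm p v)) *\<^sub>R v) \<le> 1"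
    for v :: "'z::euclidean_space"
    using p pnorm_nonneg[of p v] by (auto simp: pnorm_scaleR add_pos_nonneg field_simps)
  show thesis
  proof (cases nrm)
    case Standard
    show thesis
      by (rule that[OF scale(1)[of "(cg_pibar w, cg_pitil w, cg_sigma w, cg_rho w)"]])
        (use scale(2)[of "(cg_pibar w, cg_pitil w, cg_sigma w, cg_rho w)"] Standard
         in \<open>simp add: cg_scale_def\<close>)
  next
    case Uniform
    show thesis
      by (rule that[OF scale(1)[of "(cg_pibar w, cg_pitil w)"]])
        (use scale(2)[of "(cg_pibar w, cg_pitil w)"] Uniform in \<open>simp add: cg_scale_def\<close>)
  next
    case Cut_Coefficient
    show thesis
      by (rule that[OF scale(1)[of "(cg_alpha w, cg_beta w)"]])
        (use scale(2)[of "(cg_alpha w, cg_beta w)"] Cut_Coefficient in \<open>simp add: cg_scale_def\<close>)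
  qed
qed

section \<open>The disjunctive hull\<close>

lemma continuous_on_matrix_vector_mult [continuous_intros]:
  fixes A :: "real^'n^'m"
  shows "continuous_on S f \<Longrightarrow> continuous_on S (\<lambda>x. A *v f x)"
  by (rule bounded_linear.continuous_on[OF matrix_vector_mul_bounded_linear])

lemma continuous_on_q_obj [continuous_intros]:
  "continuous_on S f \<Longrightarrow> continuous_on S (\<lambda>x. q_obj I (f x))"
  unfolding q_obj_def by (intro continuous_intros)

lemma closed_P_set:
  assumes "closed (K_con I)"
  shows "closed (P_set I Mb Nb hb)"
proof -
  have "closed {z. conic_arg I (fst z) (snd z) \<in> K_con I}"
    using closed_vimage[OF assms, of "\<lambda>z. conic_arg I (fst z) (snd z)"]
    by (simp add: vimage_def conic_arg_def continuous_intros)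
  then show ?thesis
    unfolding P_set_def case_prod_beta less_eq_vec_def
    by (intro closed_Collect_conj closed_Collect_all closed_Collect_le continuous_intros)
qed

lemma convex_P_set:
  fixes I :: "('n1::finite, 'n2::finite, 'n3::finite, 'm1::finite, 'm2::finite, 'k::finite,
               'r2::finite) ibnp"
    and Mb :: "real^'n1^'r::finite" and Nb :: "real^'n2^'r"
  assumes K: "convex_cone (K_con I)"
  shows "convex (P_set I Mb Nb hb)"
proof (rule convexI)
  fix z z' and u v :: real
  assume z: "z \<in> P_set I Mb Nb hb" and z': "z' \<in> P_set I Mb Nb hb"
    and uv: "0 \<le> u" "0 \<le> v" "u + v = 1"
  have comb: "A *v fst (u *\<^sub>R z + v *\<^sub>R z') + B *v snd (u *\<^sub>R z + v *\<^sub>R z') - h =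
      u *\<^sub>R (A *v fst z + B *v snd z - h) + v *\<^sub>R (A *v fst z' + B *v snd z' - h)"
    for A :: "real^'n1^'q" and B :: "real^'n2^'q" and h
  proof -
    \<comment> \<open>Weights summing to one split the constant term, so the affine map commutes
      with convex combinations.\<close>
    have "h = u *\<^sub>R h + v *\<^sub>R h"
      using uv by (simp add: scaleR_add_left[symmetric])
    then show ?thesis
      by (simp add: algebra_simps matrix_vector_mult_scaleR)
  qed
  have "Mb *v fst (u *\<^sub>R z + v *\<^sub>R z') + Nb *v snd (u *\<^sub>R z + v *\<^sub>R z') - hb \<in> {v. 0 \<le> v}"
    unfolding comb using z z' uv convex_cone_nonneg_vec
    by (intro convexD) (auto simp: convex_cone_def P_set_def)
  moreover have "M_con I *v fst (u *\<^sub>R z + v *\<^sub>R z') + N_con I *v snd (u *\<^sub>R z + v *\<^sub>R z') - h_con I \<in> K_con I"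
    unfolding comb using z z' uv K
    by (intro convexD) (auto simp: convex_cone_def P_set_def conic_arg_def)
  ultimately show "u *\<^sub>R z + v *\<^sub>R z' \<in> P_set I Mb Nb hb"
    by (auto simp: P_set_def conic_arg_def case_prod_beta)
qed

lemma bounded_within_bounds: "bounded {(x, y). within_bounds I x y}"
proof -
  have "{(x, y). within_bounds I x y} \<subseteq> {lb_x I..ub_x I} \<times> {lb_y I..ub_y I}"
    by (auto simp: within_bounds_def)
  then show ?thesis
    by (rule bounded_subset[OF bounded_Times[OF bounded_closed_interval bounded_closed_interval]])
qed

text \<open>An extreme point of \<open>P\<close> lying in the hull would be extreme there as well,
  and extreme points of a convex hull belong to the generating set. But the point violates every
  disjunct.\<close>

lemma extreme_point_notin_disj_hull:
  assumes P: "convex P" and extreme: "(xs, ys) extreme_point_of P"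
    and yh: "yh \<in> F_set I xs" and better: "q_obj I yh < q_obj I ys"
  shows "(xs, ys) \<notin> disj_hull I yh P"
proof
  assume mem: "(xs, ys) \<in> disj_hull I yh P"
  have "disj_hull I yh P \<subseteq> P"
    unfolding disj_hull_def by (intro hull_minimal P) auto
  then have "(xs, ys) extreme_point_of disj_hull I yh P"
    using extreme mem by (auto simp: extreme_point_of_def)
  then obtain i where i: "disj_cond I yh i (xs, ys)"
    unfolding disj_hull_def using extreme_point_of_convex_hull by blast
  show False
  proof (cases i)
    case None
    then show False
      using i better by simp
  next
    case (Some j)
    \<comment> \<open>Follower feasibility of \<open>yh\<close> at \<open>xs\<close> is the reverse
      inequality, and the 1 subtracted in the disjunct makes the two incompatible.\<close>
    have "f_fol I $ j \<le> (A_fol I *v xs + B_fol I *v yh) $ j"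
      using yh by (simp add: F_set_def less_eq_vec_def)
    then show False
      using i Some by (simp add: matrix_vector_mul_component)
  qed
qed

text \<open>The index type is finite, so the union of the closed pieces of \<open>P\<close> is
  compact, and in finite dimension so is its convex hull.\<close>

lemma compact_disj_hull:
  assumes P: "compact P"
  shows "compact (disj_hull I yh P)"
proof -
  have "closed {z. disj_cond I yh i z}" for i
  proof (cases i)
    case None
    have "closed {z. q_obj I (snd z) \<le> q_obj I yh}"
      by (intro closed_Collect_le continuous_intros)
    moreover have "disj_cond I yh i = (\<lambda>z. q_obj I (snd z) \<le> q_obj I yh)"
      using None by auto
    ultimately show ?thesis
      by simp
  next
    case (Some j)
    have "closed {z. A_fol I $ j \<bullet> fst z \<le> f_fol I $ j - B_fol I $ j \<bullet> yh - 1}"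
      by (intro closed_Collect_le continuous_intros)
    moreover have "disj_cond I yh i = (\<lambda>z. A_fol I $ j \<bullet> fst z \<le> f_fol I $ j - B_fol I $ j \<bullet> yh - 1)"
      using Some by auto
    ultimately show ?thesis
      by simp
  qed
  then have "compact (P \<inter> {z. disj_cond I yh i z})" for i
    using P by (simp add: compact_Int_closed)
  moreover have "{z \<in> P. disj_cond I yh i z} = P \<inter> {z. disj_cond I yh i z}" for i
    by blast
  ultimately show ?thesis
    unfolding disj_hull_def by (intro compact_convex_hull compact_UN) auto
qed

theorem theorem1:
  fixes I :: "('n1::finite, 'n2::finite, 'n3::finite, 'm1::finite, 'm2::finite, 'k::finite,
               'r2::finite) ibnp"
    and Mb :: "real^'n1^'r::finite" and Nb :: "real^'n2^'r" and hb :: "real^'r"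
    and xs :: "real^'n1" and ys yh :: "real^'n2"
    and nrm :: normalization and p :: nat
    and P :: "((real^'n1) \<times> (real^'n2)) set"
  assumes P: "P = P_set I Mb Nb hb"
    and data: "valid_data I"
    and bounds: "\<forall>(x, y)\<in>hpr_set I. within_bounds I x y"
    and Y_bounded: "bounded (Y_set I)"
    and slater: "\<exists>(x, y)\<in>hpr_relax_set I. conic_arg I x y \<in> interior (K_con I)"
    and hpr_dual: "hpr_relax_dual_feasible I"
    and P_rows: "hpr_relax_rows I \<subseteq> sys_rows Mb Nb hb"
    and P_sub: "P \<subseteq> hpr_relax_set I"
    and p: "p \<in> {1, 2}"
    and cg_dual: "cg_dual_strictly_feasible I Mb Nb hb xs ys yh nrm p"
    and extreme: "(xs, ys) extreme_point_of P"
    and infeasible: "\<not> bilevel_feasible I (xs, ys)"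
    and yh: "yh \<in> F_set I xs"
    and better: "q_obj I yh < q_obj I ys"
  shows "(\<exists>\<alpha> \<beta> \<tau>. separating_cut \<alpha> \<beta> \<tau> xs ys (disj_hull I yh P)) \<and>
    (\<exists>w. cg_optimal I Mb Nb hb xs ys yh nrm p w) \<and>
    (\<forall>w. cg_optimal I Mb Nb hb xs ys yh nrm p w \<longrightarrow>
       cg_objective xs ys w > 0 \<and>
       separating_cut (cg_alpha w) (cg_beta w) (cg_tau w) xs ys (disj_hull I yh P))"
proof -
  have K: "soc_product (K_con I)"
    using data by (simp add: valid_data_def)
  note Kc = soc_product_convex_cone[OF K]
  have "bounded P"
    by (rule bounded_subset[OF bounded_within_bounds[of I]])
      (use P_sub in \<open>auto simp: hpr_relax_set_def\<close>)
  then have "compact P"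
    using closed_P_set[OF soc_product_closed[OF K]] P by (simp add: compact_eq_bounded_closed)
  then have "closed (disj_hull I yh P)"
    by (intro compact_imp_closed compact_disj_hull)
  moreover have "(xs, ys) \<notin> disj_hull I yh P"
    using convex_P_set[OF Kc] extreme yh better P by (intro extreme_point_notin_disj_hull) auto
  moreover have "convex (disj_hull I yh P)"
    by (simp add: disj_hull_def convex_convex_hull)
  ultimately obtain a \<tau> where sep: "a \<bullet> (xs, ys) < \<tau>" "\<And>z. z \<in> disj_hull I yh P \<Longrightarrow> \<tau> < a \<bullet> z"
    using separating_hyperplane_closed_point by metis
  have valid: "\<tau> < fst a \<bullet> x + snd a \<bullet> y"
    if "(x, y) \<in> P_set I Mb Nb hb" "disj_cond I yh i (x, y)" for i x y
  proof -
    have "(x, y) \<in> disj_hull I yh P"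
      unfolding disj_hull_def using that P by (intro hull_inc) auto
    from sep(2)[OF this] show ?thesis
      by (cases a) simp
  qed
  obtain w1 where w1: "cg_constraints I Mb Nb hb yh w1"
    and "cg_alpha w1 = fst a" "cg_beta w1 = snd a" "cg_tau w1 = \<tau>"
    using cg_constraints_exists[OF K P_rows valid] .
  then have obj1: "0 < cg_objective xs ys w1"
    using sep(1) by (cases a) (simp add: cg_objective_def)
  obtain c where c: "0 < c" "cg_normalized nrm p (cg_scale c w1)"
    using cg_normalized_scale[of p nrm w1] p by (metis empty_iff insert_iff zero_less_numeral zero_less_one)
  define w0 where "w0 = cg_scale c w1"
  have w0: "cg_feasible I Mb Nb hb yh nrm p w0" "0 < cg_objective xs ys w0"
    using c obj1 cg_constraints_scale[OF w1, of c]
    by (auto simp: w0_def cg_feasible_def cg_objective_scale)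
  obtain w where w: "cg_optimal I Mb Nb hb xs ys yh nrm p w"
    using cg_optimal_exists[OF cg_dual w0(1)] w0(2) by auto
  have opt: "0 < cg_objective xs ys w \<and>
      separating_cut (cg_alpha w) (cg_beta w) (cg_tau w) xs ys (disj_hull I yh P)"
    if "cg_optimal I Mb Nb hb xs ys yh nrm p w" for w
  proof -
    \<comment> \<open>An optimal solution does at least as well as the scaled point
      \<open>w0\<close>.\<close>
    have "0 < cg_objective xs ys w" "cg_constraints I Mb Nb hb yh w"
      using that w0 by (auto simp: cg_optimal_def cg_feasible_def intro: less_le_trans)
    then show ?thesis
      using cg_constraints_separating P by blast
  qed
  show ?thesis
    using w opt by blast
qed

end
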